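(* Consider the panel change point model with no change, i.e. $\tau=T$, so that $Y_{i,t}=\mu_i+\sigma\varepsilon_{i,t}$ for $1\le i\le N$, $1\le t\le T$, where $T\ge 4$ is fixed and the error vectors $[\varepsilon_{i,1},\ldots,\varepsilon_{i,T}]^{\top}$ satisfy the conditions in the context. Then, as $N\to\infty$, the statistic $\mathcal{R}_N(T)$ converges in distribution to $$\max_{t=2,\ldots,T-2}\frac{\max_{s=1,\ldots,t}\left|X_s-\frac{s}{t}X_t\right|}{\max_{s=t,\ldots,T-1}\left|Z_s-\frac{T-s}{T-t}Z_t\right|},$$ where $Z_t:=X_T-X_t$ and $[X_1,\ldots,X_T]^{\top}$ is a multivariate normal random vector with zero mean and (symmetric) covariance matrix $\Lambda=\{\lambda_{t,v}\}_{t,v=1}^{T,T}$ given by $\lambda_{t,t}=r(t)$ and $\lambda_{t,v}=r(t)+R(t,v)$ for $t<v$.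
   Context: Panel change point model: $Y_{i,t}=\mu_i+\delta_i\mathcal{I}\{t>\tau\}+\sigma\varepsilon_{i,t}$, $1\le i\le N$, $1\le t\le T$, where $\sigma>0$ is an unknown parameter, $\mu_i,\delta_i$ are (non-random) real numbers, $\tau\in\{1,\ldots,T\}$ is the common change point, and $T$ is fixed (not depending on $N$). The case $\tau=T$ (null hypothesis $H_0$) means no change in the panel means. Conditions on the errors: the vectors $[\varepsilon_{i,1},\ldots,\varepsilon_{i,T}]^{\top}$, defined on a probability space $(\Omega,\mathcal{F},\mathsf{P})$, are iid for $i=1,\ldots,N$, with $\mathsf{E}\varepsilon_{i,t}=0$, $\mathsf{Var}\,\varepsilon_{i,t}=1$, and autocorrelation function $\rho_t=\mathsf{Corr}(\varepsilon_{i,s},\varepsilon_{i,s+t})=\mathsf{Cov}(\varepsilon_{i,s},\varepsilon_{i,s+t})$ for all $s\in\{1,\ldots,T-t\}$, not depending on $s$ (with $\rho_{-t}=\rho_t$). Cumulative autocorrelation function: $r(t)=\mathsf{Var}\sum_{s=1}^t\varepsilon_{i,s}=\sum_{|s|<t}(t-|s|)\rho_s$. Shifted cumulative correlation function: $R(t,v)=\mathsf{Cov}\left(\sum_{s=1}^t\varepsilon_{i,s},\sum_{u=t+1}^v\varepsilon_{i,u}\right)=\sum_{s=1}^t\sum_{u=t+1}^v\rho_{u-s}$, $t<v$. Test statistic: $$\mathcal{R}_N(T)=\max_{t=2,\ldots,T-2}\frac{\max_{s=1,\ldots,t}\left|\sum_{i=1}^N\left[\sum_{r=1}^s\left(Y_{i,r}-\overline{Y}_{i,t}\right)\right]\right|}{\max_{s=t,\ldots,T-1}\left|\sum_{i=1}^N\left[\sum_{r=s+1}^T\left(Y_{i,r}-\widetilde{Y}_{i,t}\right)\right]\right|},$$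 with $\overline{Y}_{i,t}=\frac1t\sum_{s=1}^tY_{i,s}$ and $\widetilde{Y}_{i,t}=\frac{1}{T-t}\sum_{s=t+1}^TY_{i,s}$. *)

theory Defs
  imports "HOL-Probability.Probability"
begin

section \<open>Covariance and cumulative autocorrelation\<close>

context prob_space
begin

definition covariance :: "('a \<Rightarrow> real) \<Rightarrow> ('a \<Rightarrow> real) \<Rightarrow> real" where
  "covariance X Y = expectation (\<lambda>\<omega>. (X \<omega> - expectation X) * (Y \<omega> - expectation Y))"

definition correlation :: "('a \<Rightarrow> real) \<Rightarrow> ('a \<Rightarrow> real) \<Rightarrow> real" where
  "correlation X Y = covariance X Y / (sqrt (variance X) * sqrt (variance Y))"

text \<open>
  In the following three definitions \<open>e s\<close> is the error at time \<open>s\<close> of a single panel.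
\<close>

definition cum_autocorr :: "(nat \<Rightarrow> 'a \<Rightarrow> real) \<Rightarrow> nat \<Rightarrow> real" where
  "cum_autocorr e t = variance (\<lambda>\<omega>. \<Sum>s=1..t. e s \<omega>)"

definition shifted_cum_corr :: "(nat \<Rightarrow> 'a \<Rightarrow> real) \<Rightarrow> nat \<Rightarrow> nat \<Rightarrow> real" where
  "shifted_cum_corr e t v =
     covariance (\<lambda>\<omega>. \<Sum>s=1..t. e s \<omega>) (\<lambda>\<omega>. \<Sum>u=t+1..v. e u \<omega>)"

definition limit_cov :: "(nat \<Rightarrow> 'a \<Rightarrow> real) \<Rightarrow> nat \<Rightarrow> nat \<Rightarrow> real" where
  "limit_cov e t v =
     (if t = v then cum_autocorr e t
      else if t < v then cum_autocorr e t + shifted_cum_corr e t v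
      else cum_autocorr e v + shifted_cum_corr e v t)"

end

section \<open>Multivariate normal vectors\<close>

definition normal_law :: "real \<Rightarrow> real \<Rightarrow> real measure" where
  "normal_law m s =
     (if s = 0 then return borel m else density lborel (\<lambda>x. ennreal (normal_density m s x)))"

text \<open>
  The covariance matrix may be singular: a vector is normal if every linear combination of its
  components is univariate normal, where point masses count as normal.
\<close>

definition multivariate_normal ::
  "'a measure \<Rightarrow> nat set \<Rightarrow> (nat \<Rightarrow> 'a \<Rightarrow> real) \<Rightarrow> (nat \<Rightarrow> real) \<Rightarrow> (nat \<Rightarrow> nat \<Rightarrow> real) \<Rightarrow> bool"
where
  "multivariate_normal Q I X m C \<longleftrightarrow>
     prob_space Q \<and>
     (\<forall>t\<in>I. X t \<in> borel_measurable Q) \<and>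
     (\<forall>a. \<exists>c s. 0 \<le> s \<and> distr Q borel (\<lambda>\<omega>. \<Sum>t\<in>I. a t * X t \<omega>) = normal_law c s) \<and>
     (\<forall>t\<in>I. prob_space.expectation Q (X t) = m t) \<and>
     (\<forall>t\<in>I. \<forall>v\<in>I. prob_space.covariance Q (X t) (X v) = C t v)"

section \<open>The panel change point model\<close>

definition panel_obs ::
  "(nat \<Rightarrow> real) \<Rightarrow> (nat \<Rightarrow> real) \<Rightarrow> real \<Rightarrow> nat \<Rightarrow> (nat \<Rightarrow> nat \<Rightarrow> 'a \<Rightarrow> real) \<Rightarrow> nat \<Rightarrow> nat \<Rightarrow> 'a \<Rightarrow> real"
where
  "panel_obs \<mu> \<delta> \<sigma> \<tau> \<epsilon> i t \<omega> = \<mu> i + \<delta> i * (if t > \<tau> then 1 else 0) + \<sigma> * \<epsilon> i t \<omega>"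

text \<open>
  Panels are numbered from \<open>1\<close> and the model with \<open>N\<close> panels uses the first \<open>N\<close> of them; only
  the times \<open>1, \<dots>, T\<close> matter. Finiteness of the second moments is a consequence of the unit
  variance, since the Bochner integral of a non-integrable function is \<open>0\<close>.
\<close>

locale panel_change_point = prob_space M for M :: "'a measure" +
  fixes T \<tau> :: nat
    and \<sigma> :: real
    and \<epsilon> :: "nat \<Rightarrow> nat \<Rightarrow> 'a \<Rightarrow> real"
    and \<rho> :: "int \<Rightarrow> real"
  assumes change_point: "\<tau> \<in> {1..T}"
    and scale_pos: "\<sigma> > 0"
    and errors_indep:
      "indep_vars (\<lambda>_. Pi\<^sub>M {1..T} (\<lambda>_. borel)) (\<lambda>i \<omega>. \<lambda>t\<in>{1..T}. \<epsilon> i t \<omega>) {1..}"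
    and errors_ident:
      "\<And>i j. i \<ge> 1 \<Longrightarrow> j \<ge> 1 \<Longrightarrow>
         distr M (Pi\<^sub>M {1..T} (\<lambda>_. borel)) (\<lambda>\<omega>. \<lambda>t\<in>{1..T}. \<epsilon> i t \<omega>) =
         distr M (Pi\<^sub>M {1..T} (\<lambda>_. borel)) (\<lambda>\<omega>. \<lambda>t\<in>{1..T}. \<epsilon> j t \<omega>)"
    and errors_mean: "\<And>i t. i \<ge> 1 \<Longrightarrow> t \<in> {1..T} \<Longrightarrow> expectation (\<epsilon> i t) = 0"
    and errors_var: "\<And>i t. i \<ge> 1 \<Longrightarrow> t \<in> {1..T} \<Longrightarrow> variance (\<epsilon> i t) = 1"
    and errors_autocorr:
      "\<And>i t s. i \<ge> 1 \<Longrightarrow> t < T \<Longrightarrow> s \<in> {1..T - t} \<Longrightarrow>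
         correlation (\<epsilon> i s) (\<epsilon> i (s + t)) = \<rho> (int t)"
    and autocorr_sym: "\<And>t. \<rho> (- t) = \<rho> t"

section \<open>The ratio statistic and its limit\<close>

definition mean_before :: "(nat \<Rightarrow> nat \<Rightarrow> real) \<Rightarrow> nat \<Rightarrow> nat \<Rightarrow> real" where
  "mean_before Y i t = (1 / real t) * (\<Sum>s=1..t. Y i s)"

definition mean_after :: "nat \<Rightarrow> (nat \<Rightarrow> nat \<Rightarrow> real) \<Rightarrow> nat \<Rightarrow> nat \<Rightarrow> real" where
  "mean_after T Y i t = (1 / (real T - real t)) * (\<Sum>s=t+1..T. Y i s)"

text \<open>
  If all errors of a panel coincide almost surely, then the denominators below, both in the
  statistic and in its limit, vanish almost surely. No hypothesis excludes this case; the
  quotients then have the value \<open>0\<close>.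
\<close>

definition ratio_stat :: "nat \<Rightarrow> nat \<Rightarrow> (nat \<Rightarrow> nat \<Rightarrow> real) \<Rightarrow> real" where
  "ratio_stat T N Y =
     (MAX t\<in>{2..T-2}.
        (MAX s\<in>{1..t}. \<bar>\<Sum>i=1..N. \<Sum>r=1..s. (Y i r - mean_before Y i t)\<bar>) /
        (MAX s\<in>{t..T-1}. \<bar>\<Sum>i=1..N. \<Sum>r=s+1..T. (Y i r - mean_after T Y i t)\<bar>))"

definition ratio_limit :: "nat \<Rightarrow> (nat \<Rightarrow> real) \<Rightarrow> real" where
  "ratio_limit T x =
     (let z = (\<lambda>t. x T - x t) in
      MAX t\<in>{2..T-2}.
        (MAX s\<in>{1..t}. \<bar>x s - real s / real t * x t\<bar>) /
        (MAX s\<in>{t..T-1}. \<bar>z s - (real T - real s) / (real T - real t) * z t\<bar>))"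

section \<open>Expressions in terms of the autocorrelation function\<close>

lemma sum_differences:
  fixes f :: "int \<Rightarrow> real"
  shows "(\<Sum>a=1..t. \<Sum>b=1..t. f (int b - int a)) =
         (\<Sum>s\<in>{- int t<..<int t}. (real t - real_of_int \<bar>s\<bar>) * f s)"
proof (induction t)
  case 0
  then show ?case by simp
next
  case (Suc t)
  let ?A = "\<Sum>a=1..t. f (int (Suc t) - int a)"
  let ?B = "\<Sum>b=1..t. f (int b - int (Suc t))"
  have A: "?A = (\<Sum>s\<in>{1..int t}. f s)"
    by (rule sum.reindex_bij_witness[of _ "\<lambda>s. nat (int (Suc t) - s)" "\<lambda>a. int (Suc t) - int a"])
       auto
  have B: "?B = (\<Sum>s\<in>{- int t..-1}. f s)"
    by (rule sum.reindex_bij_witness[of _ "\<lambda>s. nat (int (Suc t) + s)" "\<lambda>b. int b - int (Suc t)"])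
       auto
  have set: "{- int (Suc t)<..<int (Suc t)} = {- int t..-1} \<union> {1..int t} \<union> {0}"
    by auto
  have all: "(\<Sum>s\<in>{- int (Suc t)<..<int (Suc t)}. f s) = ?B + ?A + f 0"
    unfolding set A B by (subst sum.union_disjoint; (subst sum.union_disjoint)?) auto
  have "(\<Sum>a=1..Suc t. \<Sum>b=1..Suc t. f (int b - int a)) =
        (\<Sum>a=1..t. \<Sum>b=1..t. f (int b - int a)) + ?A + ?B + f 0"
    by (simp add: sum.distrib)
  also have "\<dots> = (\<Sum>s\<in>{- int t<..<int t}. (real t - real_of_int \<bar>s\<bar>) * f s)
                   + (\<Sum>s\<in>{- int (Suc t)<..<int (Suc t)}. f s)"
    unfolding Suc.IH all by simp
  also have "(\<Sum>s\<in>{- int t<..<int t}. (real t - real_of_int \<bar>s\<bar>) * f s) =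
             (\<Sum>s\<in>{- int (Suc t)<..<int (Suc t)}. (real t - real_of_int \<bar>s\<bar>) * f s)"
    by (rule sum.mono_neutral_left) auto
  also have "\<dots> + (\<Sum>s\<in>{- int (Suc t)<..<int (Suc t)}. f s) =
             (\<Sum>s\<in>{- int (Suc t)<..<int (Suc t)}. (real (Suc t) - real_of_int \<bar>s\<bar>) * f s)"
    by (simp add: sum.distrib [symmetric] algebra_simps)
  finally show ?case .
qed

lemma (in prob_space) covariance_sum:
  assumes A: "finite A" "\<And>a. a \<in> A \<Longrightarrow> integrable M (X a)" "\<And>a. a \<in> A \<Longrightarrow> expectation (X a) = 0"
    and B: "finite B" "\<And>b. b \<in> B \<Longrightarrow> integrable M (Y b)" "\<And>b. b \<in> B \<Longrightarrow> expectation (Y b) = 0"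
    and XY: "\<And>a b. a \<in> A \<Longrightarrow> b \<in> B \<Longrightarrow> integrable M (\<lambda>\<omega>. X a \<omega> * Y b \<omega>)"
  shows "covariance (\<lambda>\<omega>. \<Sum>a\<in>A. X a \<omega>) (\<lambda>\<omega>. \<Sum>b\<in>B. Y b \<omega>) = (\<Sum>a\<in>A. \<Sum>b\<in>B. covariance (X a) (Y b))"
proof -
  have "expectation (\<lambda>\<omega>. \<Sum>a\<in>A. X a \<omega>) = 0" "expectation (\<lambda>\<omega>. \<Sum>b\<in>B. Y b \<omega>) = 0"
    using A B by simp_all
  then show ?thesis
    using A B XY by (simp add: covariance_def sum_product)
qed

context panel_change_point
begin

lemma error_measurable:
  assumes "i \<ge> 1" "t \<in> {1..T}"
  shows "\<epsilon> i t \<in> borel_measurable M"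
proof -
  have "(\<lambda>\<omega>. \<lambda>t\<in>{1..T}. \<epsilon> i t \<omega>) \<in> measurable M (Pi\<^sub>M {1..T} (\<lambda>_. borel))"
    using errors_indep assms(1) by (auto simp: indep_vars_def2)
  from measurable_compose[OF this measurable_component_singleton[OF assms(2)]]
  show ?thesis using assms(2) by simp
qed

lemma error_square_integrable:
  assumes "i \<ge> 1" "t \<in> {1..T}"
  shows "integrable M (\<lambda>\<omega>. (\<epsilon> i t \<omega>)\<^sup>2)"
proof (rule ccontr)
  assume "\<not> integrable M (\<lambda>\<omega>. (\<epsilon> i t \<omega>)\<^sup>2)"
  then have "expectation (\<lambda>\<omega>. (\<epsilon> i t \<omega>)\<^sup>2) = 0"
    by (rule not_integrable_integral_eq)
  then show False
    using errors_var[OF assms] errors_mean[OF assms] by simp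
qed

lemma error_integrable:
  assumes "i \<ge> 1" "t \<in> {1..T}"
  shows "integrable M (\<epsilon> i t)"
  using square_integrable_imp_integrable[OF error_measurable error_square_integrable] assms by simp

lemma error_product_integrable:
  assumes "i \<ge> 1" "s \<in> {1..T}" "t \<in> {1..T}"
  shows "integrable M (\<lambda>\<omega>. \<epsilon> i s \<omega> * \<epsilon> i t \<omega>)"
proof (rule Bochner_Integration.integrable_bound)
  show "integrable M (\<lambda>\<omega>. (\<epsilon> i s \<omega>)\<^sup>2 + (\<epsilon> i t \<omega>)\<^sup>2)"
    using error_square_integrable assms by simp
  show "(\<lambda>\<omega>. \<epsilon> i s \<omega> * \<epsilon> i t \<omega>) \<in> borel_measurable M"
    using error_measurable assms by simp
  have "\<bar>x * y\<bar> \<le> x\<^sup>2 + y\<^sup>2" for x y :: real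
  proof -
    have "0 \<le> \<bar>x\<bar> * \<bar>y\<bar>" by simp
    moreover have "2 * (\<bar>x\<bar> * \<bar>y\<bar>) \<le> x\<^sup>2 + y\<^sup>2"
      using sum_squares_bound[of "\<bar>x\<bar>" "\<bar>y\<bar>"] by (simp add: mult.assoc)
    ultimately show ?thesis
      unfolding abs_mult by linarith
  qed
  then show "AE \<omega> in M. norm (\<epsilon> i s \<omega> * \<epsilon> i t \<omega>) \<le> norm ((\<epsilon> i s \<omega>)\<^sup>2 + (\<epsilon> i t \<omega>)\<^sup>2)"
    by (intro AE_I2) simp
qed

lemma error_covariance:
  assumes i: "i \<ge> 1" and s: "s \<in> {1..T}" and u: "u \<in> {1..T}"
  shows "covariance (\<epsilon> i s) (\<epsilon> i u) = \<rho> (int u - int s)"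
proof -
  have *: "covariance (\<epsilon> i a) (\<epsilon> i b) = \<rho> (int b - int a)"
    if "a \<in> {1..T}" "b \<in> {1..T}" "a \<le> b" for a b
  proof -
    have "correlation (\<epsilon> i a) (\<epsilon> i (a + (b - a))) = \<rho> (int (b - a))"
      using that by (intro errors_autocorr i) auto
    then show ?thesis
      using that errors_var[OF i that(1)] errors_var[OF i that(2)]
      by (simp add: correlation_def of_nat_diff)
  qed
  show ?thesis
  proof (cases "s \<le> u")
    case True
    then show ?thesis using * s u by simp
  next
    case False
    then have "covariance (\<epsilon> i u) (\<epsilon> i s) = \<rho> (int s - int u)"
      using * s u by simp
    then show ?thesis
      using autocorr_sym[of "int s - int u"] by (simp add: covariance_def mult.commute)
  qed
qed

text \<open>In particular the two functions and \<^const>\<open>limit_cov\<close> do not depend on the panel.\<close>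

lemma cum_autocorr_eq:
  assumes "i \<ge> 1" "t \<le> T"
  shows "cum_autocorr (\<epsilon> i) t = (\<Sum>s\<in>{- int t<..<int t}. (real t - real_of_int \<bar>s\<bar>) * \<rho> s)"
proof -
  have "cum_autocorr (\<epsilon> i) t =
        covariance (\<lambda>\<omega>. \<Sum>a=1..t. \<epsilon> i a \<omega>) (\<lambda>\<omega>. \<Sum>b=1..t. \<epsilon> i b \<omega>)"
    by (simp add: cum_autocorr_def covariance_def power2_eq_square)
  also have "\<dots> = (\<Sum>a=1..t. \<Sum>b=1..t. covariance (\<epsilon> i a) (\<epsilon> i b))"
    using assms by (intro covariance_sum error_integrable errors_mean error_product_integrable) auto
  also have "\<dots> = (\<Sum>a=1..t. \<Sum>b=1..t. \<rho> (int b - int a))"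
    using assms by (intro sum.cong refl error_covariance) auto
  finally show ?thesis
    by (simp only: sum_differences)
qed

lemma shifted_cum_corr_eq:
  assumes "i \<ge> 1" "t < v" "v \<le> T"
  shows "shifted_cum_corr (\<epsilon> i) t v = (\<Sum>s=1..t. \<Sum>u=t+1..v. \<rho> (int u - int s))"
proof -
  have "shifted_cum_corr (\<epsilon> i) t v = (\<Sum>s=1..t. \<Sum>u=t+1..v. covariance (\<epsilon> i s) (\<epsilon> i u))"
    unfolding shifted_cum_corr_def
    using assms by (intro covariance_sum error_integrable errors_mean error_product_integrable) auto
  also have "\<dots> = (\<Sum>s=1..t. \<Sum>u=t+1..v. \<rho> (int u - int s))"
    using assms by (intro sum.cong refl error_covariance) auto
  finally show ?thesis .
qed

end

end

theory Submission
  imports Defs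
begin

text \<open>
  Without a change point the statistic is not merely asymptotically but exactly a function of the
  partial sums of the errors, summed over the panels: centring removes the means \<open>\<mu> i\<close>, and the factor
  \<open>\<sigma>\<close> cancels in every quotient (\<open>ratio_stat_no_change\<close>). That function is
  \<^const>\<open>ratio_limit\<close> itself. As it is invariant under scaling, its argument may be divided
  by \<open>sqrt N\<close>, and the vector of scaled partial sums tends in law to the normal vector \<open>X\<close>
  (\<open>panel_sums_tend_in_law\<close>). It remains to pass to the limit inside \<^const>\<open>ratio_limit\<close>.

  The multivariate central limit theorem is reduced to the univariate one by the Cramer--Wold device
  (\<open>cramer_wold\<close>). The latter is proved by approximating a bounded continuous function of several
  variables by trigonometric polynomials, through the Stone--Weierstrass theorem on a torus of growing size.
  Only univariate laws enter, and point masses are allowed among them, which covers singular covariance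
  matrices.

  The functional \<^const>\<open>ratio_limit\<close> is discontinuous where a denominator vanishes, and there
  are two cases. All denominators are nonzero wherever the linear form
  \<open>x T - 2 * x (T - 1) + x (T - 2)\<close> is. On partial sums of a panel this form is the last error increment,
  with variance \<open>2 - 2 * \<rho> 1\<close>. If \<open>\<rho> 1 \<noteq> 1\<close>, the form is a nondegenerate normal variable in the limit, which
  is almost surely nonzero, and the continuous mapping theorem applies
  (\<open>ratio_limit_tends_nondegenerate\<close>). If \<open>\<rho> 1 = 1\<close>, then all errors of a panel coincide almost surely, the partial
  sums and their limit are linear in time, and \<^const>\<open>ratio_limit\<close> is \<open>0\<close> on both sides
  (\<open>ratio_limit_tends_degenerate\<close>).
\<close>

section \<open>Convergence in law\<close>

text \<open>
  The variables of the sequence and the limit may live on different probability spaces, and they may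
  take values in any topological space, such as the real functions on a set of times. The
  bound \<open>1\<close> on the test functions loses nothing, because every bounded function can be rescaled.
\<close>

definition tends_in_law ::
  "'a measure \<Rightarrow> (nat \<Rightarrow> 'a \<Rightarrow> 's::topological_space) \<Rightarrow> 'b measure \<Rightarrow> ('b \<Rightarrow> 's) \<Rightarrow> bool"
where
  "tends_in_law M V Q Y \<longleftrightarrow>
     (\<forall>f. continuous_on UNIV f \<longrightarrow> (\<forall>x. \<bar>f x :: real\<bar> \<le> 1) \<longrightarrow>
        (\<lambda>n. \<integral>\<omega>. f (V n \<omega>) \<partial>M) \<longlonglongrightarrow> (\<integral>\<omega>. f (Y \<omega>) \<partial>Q))"

lemma tends_in_lawD:
  assumes "tends_in_law M V Q Y" "continuous_on UNIV f" "\<And>x. \<bar>f x :: real\<bar> \<le> 1"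
  shows "(\<lambda>n. \<integral>\<omega>. f (V n \<omega>) \<partial>M) \<longlonglongrightarrow> (\<integral>\<omega>. f (Y \<omega>) \<partial>Q)"
  using assms unfolding tends_in_law_def by blast

lemma tends_in_law_continuous_image:
  fixes g :: "'s::topological_space \<Rightarrow> 't::topological_space"
  assumes "tends_in_law M V Q Y" "continuous_on UNIV g"
  shows "tends_in_law M (\<lambda>n \<omega>. g (V n \<omega>)) Q (\<lambda>\<omega>. g (Y \<omega>))"
  unfolding tends_in_law_def
proof (intro allI impI)
  fix f :: "'t \<Rightarrow> real" assume "continuous_on UNIV f" "\<forall>x. \<bar>f x\<bar> \<le> 1"
  then show "(\<lambda>n. \<integral>\<omega>. f (g (V n \<omega>)) \<partial>M) \<longlonglongrightarrow> (\<integral>\<omega>. f (g (Y \<omega>)) \<partial>Q)"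
    using assms(2) continuous_on_compose2[of UNIV f UNIV g]
    by (intro tends_in_lawD[OF assms(1)]) auto
qed

lemma tends_in_law_imp_weak_conv_m:
  fixes V :: "nat \<Rightarrow> 'a \<Rightarrow> real"
  assumes "prob_space M" "prob_space Q"
    and [measurable]: "\<And>n. V n \<in> borel_measurable M" "Y \<in> borel_measurable Q"
    and "tends_in_law M V Q Y"
  shows "weak_conv_m (\<lambda>n. distr M borel (V n)) (distr Q borel Y)"
proof (rule integral_bdd_continuous_conv_imp_weak_conv)
  interpret M: prob_space M by fact
  interpret Q: prob_space Q by fact
  show "real_distribution (distr M borel (V n))" for n by simp
  show "real_distribution (distr Q borel Y)" by simp
  fix f :: "real \<Rightarrow> real" assume f: "\<And>x. isCont f x" "\<And>x. \<bar>f x\<bar> \<le> 1"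
  then have c: "continuous_on UNIV f"
    by (simp add: continuous_at_imp_continuous_on)
  then have [measurable]: "f \<in> borel_measurable borel"
    by (rule borel_measurable_continuous_onI)
  show "(\<lambda>n. \<integral>x. f x \<partial>distr M borel (V n)) \<longlonglongrightarrow> (\<integral>x. f x \<partial>distr Q borel Y)"
    using tends_in_lawD[OF assms(5) c f(2)] by (simp add: integral_distr)
qed

lemma weak_conv_m_imp_tends_in_law:
  fixes V :: "nat \<Rightarrow> 'a \<Rightarrow> real"
  assumes "prob_space M" "prob_space Q"
    and [measurable]: "\<And>n. V n \<in> borel_measurable M" "Y \<in> borel_measurable Q"
    and "weak_conv_m (\<lambda>n. distr M borel (V n)) (distr Q borel Y)"
  shows "tends_in_law M V Q Y"
  unfolding tends_in_law_def
proof (intro allI impI)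
  interpret M: prob_space M by fact
  interpret Q: prob_space Q by fact
  fix f :: "real \<Rightarrow> real" assume c: "continuous_on UNIV f" and "\<forall>x. \<bar>f x\<bar> \<le> 1"
  from c have [measurable]: "f \<in> borel_measurable borel"
    by (rule borel_measurable_continuous_onI)
  have "(\<lambda>n. \<integral>x. f x \<partial>distr M borel (V n)) \<longlonglongrightarrow> (\<integral>x. f x \<partial>distr Q borel Y)"
    using c \<open>\<forall>x. \<bar>f x\<bar> \<le> 1\<close> assms(5)
    by (intro weak_conv_imp_integral_bdd_continuous_conv[where B = 1])
       (simp_all add: continuous_on_eq_continuous_at)
  then show "(\<lambda>n. \<integral>\<omega>. f (V n \<omega>) \<partial>M) \<longlonglongrightarrow> (\<integral>\<omega>. f (Y \<omega>) \<partial>Q)"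
    by (simp add: integral_distr)
qed

lemma abs_integral_diff_le:
  fixes u v w :: "'a \<Rightarrow> real"
  assumes "integrable P u" "integrable P v" "integrable P w" "\<And>\<omega>. \<bar>u \<omega> - v \<omega>\<bar> \<le> w \<omega>"
  shows "\<bar>(\<integral>\<omega>. u \<omega> \<partial>P) - (\<integral>\<omega>. v \<omega> \<partial>P)\<bar> \<le> (\<integral>\<omega>. w \<omega> \<partial>P)"
proof -
  have "\<bar>(\<integral>\<omega>. u \<omega> \<partial>P) - (\<integral>\<omega>. v \<omega> \<partial>P)\<bar> = \<bar>\<integral>\<omega>. u \<omega> - v \<omega> \<partial>P\<bar>"
    using assms by simp
  also have "\<dots> \<le> (\<integral>\<omega>. \<bar>u \<omega> - v \<omega>\<bar> \<partial>P)"
    by (rule integral_abs_bound)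
  also have "\<dots> \<le> (\<integral>\<omega>. w \<omega> \<partial>P)"
    using assms by (intro integral_mono) auto
  finally show ?thesis .
qed

text \<open>
  The mapping theorem and the Cramer--Wold device both take limits of expectations in this way: the
  test function of interest is replaced by one for which convergence is known, and the error is dominated by the expectation of
  another function for which convergence is also known.
\<close>

lemma tendsto_if_approximable:
  fixes a :: "nat \<Rightarrow> real" and g h :: "nat \<Rightarrow> nat \<Rightarrow> real"
  assumes g: "\<And>k. g k \<longlonglongrightarrow> G k" and h: "\<And>k. h k \<longlonglongrightarrow> H k"
    and a: "\<And>k n. \<bar>a n - g k n\<bar> \<le> h k n" and l: "\<And>k. \<bar>l - G k\<bar> \<le> H k"
    and H: "H \<longlonglongrightarrow> 0"
  shows "a \<longlonglongrightarrow> l"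
proof (rule tendstoI)
  fix e :: real assume "e > 0"
  then have "\<forall>\<^sub>F k in sequentially. H k < e / 4"
    by (intro order_tendstoD(2)[OF H]) simp
  then obtain k where k: "H k < e / 4"
    by (auto simp: eventually_sequentially)
  have "\<forall>\<^sub>F n in sequentially. dist (g k n) (G k) < e / 4"
    using \<open>e > 0\<close> by (intro tendstoD[OF g]) simp
  moreover have "\<forall>\<^sub>F n in sequentially. h k n < e / 2"
    using k \<open>e > 0\<close> by (intro order_tendstoD(2)[OF h]) simp
  ultimately show "\<forall>\<^sub>F n in sequentially. dist (a n) l < e"
  proof eventually_elim
    case (elim n)
    then show ?case
      using a[of n k] l[of k] k unfolding dist_real_def by linarith
  qed
qed

text \<open>
  The function \<open>g\<close> may be discontinuous on the zero set of \<open>d\<close>, which the limit avoids almost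
  surely. For a test function \<open>f\<close>, multiplying \<open>f \<circ> g\<close> by the cutoff \<open>min 1 ((k + 1) * \<bar>d\<bar>)\<close> makes it continuous everywhere,
  and the error is at most one minus the cutoff. That bound is itself continuous, so its expectation
  converges along the sequence, and in the limit it tends to \<open>0\<close> as \<open>k\<close> grows.
\<close>

lemma tends_in_law_ae_continuous_image:
  fixes V :: "nat \<Rightarrow> 'a \<Rightarrow> 's::t2_space" and g :: "'s \<Rightarrow> real"
  assumes "prob_space M" "prob_space Q"
    and [measurable]: "\<And>n. V n \<in> borel_measurable M" "Y \<in> borel_measurable Q"
      "g \<in> borel_measurable borel"
    and VY: "tends_in_law M V Q Y"
    and d: "continuous_on UNIV (d :: 's \<Rightarrow> real)"
    and g: "continuous_on {x. d x \<noteq> 0} g"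
    and nz: "AE \<omega> in Q. d (Y \<omega>) \<noteq> 0"
  shows "tends_in_law M (\<lambda>n \<omega>. g (V n \<omega>)) Q (\<lambda>\<omega>. g (Y \<omega>))"
  unfolding tends_in_law_def
proof (intro allI impI)
  interpret M: prob_space M by fact
  interpret Q: prob_space Q by fact
  fix f :: "real \<Rightarrow> real" assume f: "continuous_on UNIV f" "\<forall>x. \<bar>f x\<bar> \<le> 1"
  have [measurable]: "f \<in> borel_measurable borel" "d \<in> borel_measurable borel"
    using f(1) d by (auto intro: borel_measurable_continuous_onI)
  define \<kappa> where "\<kappa> k x = min 1 (real (Suc k) * \<bar>d x\<bar>)" for k x
  define \<phi> where "\<phi> k x = f (g x) * \<kappa> k x" for k x
  have \<kappa>: "0 \<le> \<kappa> k x" "\<kappa> k x \<le> 1" for k x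
    by (simp_all add: \<kappa>_def)
  have cont_\<kappa>: "continuous_on UNIV (\<kappa> k)" for k
    unfolding \<kappa>_def by (intro continuous_intros d)
  have [measurable]: "\<kappa> k \<in> borel_measurable borel" for k
    by (intro borel_measurable_continuous_onI cont_\<kappa>)
  have op: "open {x. d x \<noteq> 0}"
    by (intro open_Collect_neq d continuous_on_const)
  have "isCont (\<phi> k) x" for k x
  proof (cases "d x = 0")
    case True
    then have 0: "\<kappa> k x = 0"
      by (simp add: \<kappa>_def)
    have "(\<kappa> k \<longlongrightarrow> 0) (at x)"
      using cont_\<kappa>[of k] 0 by (metis continuous_on_eq_continuous_at isCont_def open_UNIV UNIV_I)
    then have "(\<phi> k \<longlongrightarrow> 0) (at x)"
    proof (rule Lim_null_comparison[rotated])
      have "norm (\<phi> k y) \<le> \<kappa> k y" for y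
        using f(2) \<kappa>[of k y] by (simp add: \<phi>_def abs_mult mult_left_le_one_le)
      then show "\<forall>\<^sub>F y in at x. norm (\<phi> k y) \<le> \<kappa> k y"
        by simp
    qed
    then show ?thesis
      using 0 by (simp add: isCont_def \<phi>_def)
  next
    case False
    have "continuous_on {x. d x \<noteq> 0} (\<phi> k)"
      unfolding \<phi>_def
      by (intro continuous_intros continuous_on_compose2[OF f(1) g]
          continuous_on_subset[OF cont_\<kappa>]) auto
    then show ?thesis
      using op False by (simp add: continuous_on_eq_continuous_at)
  qed
  then have cont_\<phi>: "continuous_on UNIV (\<phi> k)" for k
    by (simp add: continuous_on_eq_continuous_at)
  have [measurable]: "\<phi> k \<in> borel_measurable borel" for k
    by (intro borel_measurable_continuous_onI cont_\<phi>)
  have \<phi>_bound: "\<bar>\<phi> k x\<bar> \<le> 1" for k x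
    using f(2) \<kappa>[of k x] by (simp add: \<phi>_def abs_mult mult_le_one)
  have err: "\<bar>f (g x) - \<phi> k x\<bar> \<le> 1 - \<kappa> k x" for k x
  proof -
    have "f (g x) - \<phi> k x = f (g x) * (1 - \<kappa> k x)"
      by (simp add: \<phi>_def algebra_simps)
    then have "\<bar>f (g x) - \<phi> k x\<bar> = \<bar>f (g x)\<bar> * (1 - \<kappa> k x)"
      using \<kappa>(2)[of k x] by (simp only: abs_mult)
    also have "\<dots> \<le> 1 * (1 - \<kappa> k x)"
      using f(2) \<kappa>[of k x] by (intro mult_right_mono) auto
    finally show ?thesis by simp
  qed
  have err_int: "\<bar>(\<integral>\<omega>. f (g (W \<omega>)) \<partial>P) - (\<integral>\<omega>. \<phi> k (W \<omega>) \<partial>P)\<bar> \<le> (\<integral>\<omega>. 1 - \<kappa> k (W \<omega>) \<partial>P)"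
    if "prob_space P" and [measurable]: "W \<in> borel_measurable P" for P :: "'c measure" and W k
  proof -
    interpret P: prob_space P by fact
    show ?thesis
    proof (rule abs_integral_diff_le[OF _ _ _ err])
      show "integrable P (\<lambda>\<omega>. f (g (W \<omega>)))" "integrable P (\<lambda>\<omega>. \<phi> k (W \<omega>))"
        "integrable P (\<lambda>\<omega>. 1 - \<kappa> k (W \<omega>))"
        using f(2) \<phi>_bound \<kappa> by (auto intro!: P.integrable_const_bound[where B = 1])
    qed
  qed
  show "(\<lambda>n. \<integral>\<omega>. f (g (V n \<omega>)) \<partial>M) \<longlonglongrightarrow> (\<integral>\<omega>. f (g (Y \<omega>)) \<partial>Q)"
  proof (rule tendsto_if_approximable)
    show "(\<lambda>n. \<integral>\<omega>. \<phi> k (V n \<omega>) \<partial>M) \<longlonglongrightarrow> (\<integral>\<omega>. \<phi> k (Y \<omega>) \<partial>Q)" for k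
      by (rule tends_in_lawD[OF VY cont_\<phi> \<phi>_bound])
    show "(\<lambda>n. \<integral>\<omega>. 1 - \<kappa> k (V n \<omega>) \<partial>M) \<longlonglongrightarrow> (\<integral>\<omega>. 1 - \<kappa> k (Y \<omega>) \<partial>Q)" for k
      using \<kappa>[of k] by (intro tends_in_lawD[OF VY] continuous_intros cont_\<kappa>) auto
    have "(\<lambda>k. \<integral>\<omega>. 1 - \<kappa> k (Y \<omega>) \<partial>Q) \<longlonglongrightarrow> (\<integral>\<omega>. 0 \<partial>Q)"
    proof (rule integral_dominated_convergence[where w = "\<lambda>_. 1"])
      show "AE \<omega> in Q. (\<lambda>k. 1 - \<kappa> k (Y \<omega>)) \<longlonglongrightarrow> 0"
        using nz
      proof eventually_elim
        case (elim \<omega>)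
        have "\<forall>\<^sub>F k in sequentially. 1 / \<bar>d (Y \<omega>)\<bar> \<le> real k"
          using filterlim_real_sequentially by (simp add: filterlim_at_top)
        then have "\<forall>\<^sub>F k in sequentially. 1 - \<kappa> k (Y \<omega>) = 0"
        proof eventually_elim
          case (elim k)
          with \<open>d (Y \<omega>) \<noteq> 0\<close> have "1 \<le> real (Suc k) * \<bar>d (Y \<omega>)\<bar>"
            by (simp add: field_simps)
          then show ?case by (simp add: \<kappa>_def)
        qed
        then show ?case by (rule tendsto_eventually)
      qed
      show "AE \<omega> in Q. norm (1 - \<kappa> k (Y \<omega>)) \<le> 1" for k
        using \<kappa>[of k] by simp
    qed simp_all
    then show "(\<lambda>k. \<integral>\<omega>. 1 - \<kappa> k (Y \<omega>) \<partial>Q) \<longlonglongrightarrow> 0"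
      by simp
  qed (auto intro!: err_int assms(1,2))
qed

section \<open>The Cramer-Wold device\<close>

text \<open>
  The span of all plane waves in the coordinates from \<open>I\<close>. The phase \<open>b\<close> makes sines a special case, and
  the product of two waves is a sum of two waves of the same form.
\<close>

inductive trig_poly :: "'i set \<Rightarrow> (('i \<Rightarrow> real) \<Rightarrow> real) \<Rightarrow> bool" for I where
  wave: "trig_poly I (\<lambda>x. c * cos ((\<Sum>i\<in>I. a i * x i) + b))"
| add: "trig_poly I p \<Longrightarrow> trig_poly I q \<Longrightarrow> trig_poly I (\<lambda>x. p x + q x)"

lemma trig_poly_mult:
  assumes "trig_poly I p" "trig_poly I q"
  shows "trig_poly I (\<lambda>x. p x * q x)"
  using assms(1)
proof induction
  case (wave c a b)
  from assms(2) show ?case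
  proof induction
    case (wave c' a' b')
    have "c * cos ((\<Sum>i\<in>I. a i * x i) + b) * (c' * cos ((\<Sum>i\<in>I. a' i * x i) + b')) =
      (c * c' / 2) * cos ((\<Sum>i\<in>I. (a i - a' i) * x i) + (b - b')) +
      (c * c' / 2) * cos ((\<Sum>i\<in>I. (a i + a' i) * x i) + (b + b'))" for x
    proof -
      have "cos ((\<Sum>i\<in>I. a i * x i) + b) * cos ((\<Sum>i\<in>I. a' i * x i) + b') =
        (cos (((\<Sum>i\<in>I. a i * x i) + b) - ((\<Sum>i\<in>I. a' i * x i) + b')) +
         cos (((\<Sum>i\<in>I. a i * x i) + b) + ((\<Sum>i\<in>I. a' i * x i) + b'))) / 2"
        by (rule cos_times_cos)
      also have "((\<Sum>i\<in>I. a i * x i) + b) - ((\<Sum>i\<in>I. a' i * x i) + b') =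
        (\<Sum>i\<in>I. (a i - a' i) * x i) + (b - b')"
        by (simp add: left_diff_distrib sum_subtractf)
      also have "((\<Sum>i\<in>I. a i * x i) + b) + ((\<Sum>i\<in>I. a' i * x i) + b') =
        (\<Sum>i\<in>I. (a i + a' i) * x i) + (b + b')"
        by (simp add: distrib_right sum.distrib)
      finally show ?thesis
        by (simp add: field_simps)
    qed
    then show ?case
      by (simp only:) (intro trig_poly.intros)
  next
    case (add p q)
    then show ?case
      by (simp only: distrib_left) (rule trig_poly.add)
  qed
next
  case (add p q)
  then show ?case
    by (simp only: distrib_right) (rule trig_poly.add)
qed

text \<open>
  The topology on functions is the product topology over the whole index type; outside \<open>I\<close> an
  extensional function lies in a singleton, so that Tychonoff's theorem still applies.
\<close>

lemma compact_PiE: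
  fixes S :: "'i \<Rightarrow> 'b::topological_space set"
  assumes "\<And>i. i \<in> I \<Longrightarrow> compact (S i)"
  shows "compact (PiE I S)"
proof -
  have eq: "PiE I S = PiE UNIV (\<lambda>i. if i \<in> I then S i else {undefined})"
    by (auto simp: PiE_iff extensional_def split: if_splits)
  have "compactin (product_topology (\<lambda>_. euclidean) UNIV) (PiE I S)"
    unfolding eq compactin_PiE using assms by auto
  then show ?thesis
    by (simp add: euclidean_product_topology)
qed

text \<open>
  The torus is compact, and on it the real and imaginary parts of the coordinates separate points.
  Pulled back along \<open>x \<mapsto> (cis (x i / L))\<^sub>i\<close> they are waves, so by the Stone--Weierstrass
  theorem every continuous function on the torus pulls back to a uniform limit of trigonometric
  polynomials.
\<close>

lemma trig_poly_dense:
  fixes F :: "('i::countable \<Rightarrow> complex) \<Rightarrow> real"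
  assumes I: "finite I" and F: "continuous_on (PiE I (\<lambda>_. sphere 0 1)) F" and "e > 0"
  obtains p where "trig_poly I p" "\<And>x. \<bar>F (\<lambda>i\<in>I. cis (x i / L)) - p x\<bar> < e"
proof -
  let ?S = "PiE I (\<lambda>_. sphere 0 1) :: ('i \<Rightarrow> complex) set"
  let ?P = "\<lambda>g. continuous_on ?S g \<and> trig_poly I (\<lambda>x. g (\<lambda>i\<in>I. cis (x i / L)))"
  have coord: "continuous_on ?S (\<lambda>w. w i)" for i
    by (rule continuous_on_subset[OF continuous_on_product_coordinates]) simp
  have Re: "?P (\<lambda>w. Re (w i))" and Im: "?P (\<lambda>w. Im (w i))" if i: "i \<in> I" for i
  proof -
    have *: "(\<Sum>j\<in>I. of_bool (j = i) / L * x j) = x i / L" for x :: "'i \<Rightarrow> real"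
      using I i by (simp add: sum.remove[of I i])
    show "?P (\<lambda>w. Re (w i))"
      using i trig_poly.wave[of I 1 "\<lambda>j. of_bool (j = i) / L" 0]
      by (auto intro!: continuous_intros coord simp only: * ) simp
    show "?P (\<lambda>w. Im (w i))"
      using i trig_poly.wave[of I 1 "\<lambda>j. of_bool (j = i) / L" "-(pi/2)"]
      by (auto intro!: continuous_intros coord simp only: * ) (simp add: cos_diff)
  qed
  have "\<exists>g. ?P g \<and> (\<forall>w\<in>?S. \<bar>F w - g w\<bar> < e)"
  proof (rule Stone_Weierstrass_HOL[where P = ?P])
    show "compact ?S" by (rule compact_PiE) simp
    show "?P (\<lambda>_. c)" for c
      using trig_poly.wave[of I c "\<lambda>_. 0" 0] by simp
    show "?P (\<lambda>w. f w + g w)" if "?P f \<and> ?P g" for f g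
      using that by (auto intro: continuous_intros trig_poly.add)
    show "?P (\<lambda>w. f w * g w)" if "?P f \<and> ?P g" for f g
      using that by (auto intro: continuous_intros trig_poly_mult)
    show "\<exists>f. ?P f \<and> f w \<noteq> f w'" if "w \<in> ?S \<and> w' \<in> ?S \<and> w \<noteq> w'" for w w'
    proof -
      from that obtain i where "i \<in> I" "w i \<noteq> w' i"
        by (meson PiE_ext)
      then have "Re (w i) \<noteq> Re (w' i) \<or> Im (w i) \<noteq> Im (w' i)"
        by (simp add: complex_eq_iff)
      then show ?thesis
        using Re[OF \<open>i \<in> I\<close>] Im[OF \<open>i \<in> I\<close>] by blast
    qed
  qed (use F \<open>e > 0\<close> in auto)
  then obtain g where "?P g" "\<forall>w\<in>?S. \<bar>F w - g w\<bar> < e" by blast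
  then show thesis
    by (intro that[of "\<lambda>x. g (\<lambda>i\<in>I. cis (x i / L))"]) (auto simp: norm_cis)
qed

lemma one_minus_prod_cos_le:
  fixes y :: "'i \<Rightarrow> real"
  assumes "finite I" "\<And>i. i \<in> I \<Longrightarrow> \<bar>y i\<bar> \<le> 1"
  shows "1 - (\<Prod>i\<in>I. cos (y i)) \<le> (\<Sum>i\<in>I. (y i)\<^sup>2)"
proof -
  have c: "0 \<le> cos (y i)" "cos (y i) \<le> 1" if "i \<in> I" for i
    using assms(2)[OF that] pi_half_gt_zero pi_gt3 by (auto intro!: cos_ge_zero)
  have "1 - (\<Sum>i\<in>I. 1 - cos (y i)) \<le> (\<Prod>i\<in>I. 1 - (1 - cos (y i)))"
    using c by (intro Weierstrass_prod_ineq) auto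
  then have "1 - (\<Prod>i\<in>I. cos (y i)) \<le> (\<Sum>i\<in>I. 1 - cos (y i))"
    by simp
  also have "\<dots> \<le> (\<Sum>i\<in>I. (y i)\<^sup>2)"
  proof (rule sum_mono)
    fix i
    have "cos (y i) = 1 - 2 * (sin (y i / 2))\<^sup>2"
      using cos_double_sin[of "y i / 2"] by simp
    moreover have "(sin (y i / 2))\<^sup>2 \<le> (y i / 2)\<^sup>2"
      using abs_sin_x_le_abs_x[of "y i / 2"] by (simp only: abs_le_square_iff)
    then have "(sin (y i / 2))\<^sup>2 \<le> (y i)\<^sup>2 / 4"
      by (simp add: power_divide)
    ultimately show "1 - cos (y i) \<le> (y i)\<^sup>2"
      using zero_le_power2[of "y i"] by linarith
  qed
  finally show ?thesis .
qed

lemma measurable_restrict_function: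
  fixes W :: "'i::countable \<Rightarrow> 'a \<Rightarrow> real"
  assumes "\<And>i. i \<in> I \<Longrightarrow> W i \<in> borel_measurable P"
  shows "(\<lambda>\<omega>. \<lambda>i\<in>I. W i \<omega>) \<in> borel_measurable P"
proof (rule measurable_coordinatewise_then_product)
  show "(\<lambda>\<omega>. (\<lambda>i\<in>I. W i \<omega>) i) \<in> borel_measurable P" for i
    using assms by (cases "i \<in> I") simp_all
qed

text \<open>
  Convergence of all linear combinations gives convergence of the expectation of every wave, hence of
  every trigonometric polynomial, hence of every function that factors through a torus. A
  bounded continuous \<open>f\<close> does not factor, but it is close to one that does: wrap
  the line around a circle of circumference \<open>2 * pi * L\<close> and read a point of the right half circle back
  through \<open>arcsin\<close>. A product of positive parts of cosines damps \<open>f\<close> to \<open>0\<close> towards the left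
  half, where reading back fails. For \<open>L \<rightarrow> \<infinity>\<close> the error vanishes, since it is bounded by a sum of
  truncated squares \<open>min 1 ((x i / L)\<^sup>2)\<close>; these depend on one coordinate each, so their
  expectations converge along the sequence as well.
\<close>

lemma cramer_wold:
  fixes V :: "nat \<Rightarrow> 'i::countable \<Rightarrow> 'a \<Rightarrow> real" and Y :: "'i \<Rightarrow> 'b \<Rightarrow> real"
  assumes M: "prob_space M" and Q: "prob_space Q" and I: "finite I"
    and V[measurable]: "\<And>n i. i \<in> I \<Longrightarrow> V n i \<in> borel_measurable M"
    and Y[measurable]: "\<And>i. i \<in> I \<Longrightarrow> Y i \<in> borel_measurable Q"
    and lin: "\<And>a. tends_in_law M (\<lambda>n \<omega>. \<Sum>i\<in>I. a i * V n i \<omega>) Q (\<lambda>\<omega>. \<Sum>i\<in>I. a i * Y i \<omega>)"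
  shows "tends_in_law M (\<lambda>n \<omega>. \<lambda>i\<in>I. V n i \<omega>) Q (\<lambda>\<omega>. \<lambda>i\<in>I. Y i \<omega>)"
  unfolding tends_in_law_def
proof (intro allI impI)
  interpret M: prob_space M by fact
  interpret Q: prob_space Q by fact
  fix f :: "('i \<Rightarrow> real) \<Rightarrow> real" assume f: "continuous_on UNIV f" "\<forall>x. \<bar>f x\<bar> \<le> 1"
  have trig: "integrable M (\<lambda>\<omega>. p (\<lambda>i\<in>I. V n i \<omega>))" "integrable Q (\<lambda>\<omega>. p (\<lambda>i\<in>I. Y i \<omega>))"
    "(\<lambda>n. \<integral>\<omega>. p (\<lambda>i\<in>I. V n i \<omega>) \<partial>M) \<longlonglongrightarrow> (\<integral>\<omega>. p (\<lambda>i\<in>I. Y i \<omega>) \<partial>Q)"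
    if "trig_poly I p" for p n
  proof -
    have "(\<forall>n. integrable M (\<lambda>\<omega>. p (\<lambda>i\<in>I. V n i \<omega>))) \<and> integrable Q (\<lambda>\<omega>. p (\<lambda>i\<in>I. Y i \<omega>)) \<and>
      (\<lambda>n. \<integral>\<omega>. p (\<lambda>i\<in>I. V n i \<omega>) \<partial>M) \<longlonglongrightarrow> (\<integral>\<omega>. p (\<lambda>i\<in>I. Y i \<omega>) \<partial>Q)"
      using that
    proof induction
      case (wave c a b)
      have int: "integrable P (\<lambda>\<omega>. cos ((\<Sum>i\<in>I. a i * W i \<omega>) + b))"
        if "prob_space P" "\<And>i. i \<in> I \<Longrightarrow> W i \<in> borel_measurable P" for P :: "'c measure" and W
      proof -
        interpret P: prob_space P by fact
        note that(2)[measurable]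
        show ?thesis
          by (rule P.integrable_const_bound[where B = 1]) auto
      qed
      have "(\<lambda>n. \<integral>\<omega>. cos ((\<Sum>i\<in>I. a i * V n i \<omega>) + b) \<partial>M)
          \<longlonglongrightarrow> (\<integral>\<omega>. cos ((\<Sum>i\<in>I. a i * Y i \<omega>) + b) \<partial>Q)"
        by (rule tends_in_lawD[OF lin, where f = "\<lambda>x. cos (x + b)"])
           (auto intro!: continuous_intros)
      then show ?case
        using int[OF M V] int[OF Q Y] by (auto intro!: tendsto_mult_left)
    next
      case (add p q)
      then show ?case by (auto intro!: tendsto_add)
    qed
    then show "integrable M (\<lambda>\<omega>. p (\<lambda>i\<in>I. V n i \<omega>))" "integrable Q (\<lambda>\<omega>. p (\<lambda>i\<in>I. Y i \<omega>))"
      "(\<lambda>n. \<integral>\<omega>. p (\<lambda>i\<in>I. V n i \<omega>) \<partial>M) \<longlonglongrightarrow> (\<integral>\<omega>. p (\<lambda>i\<in>I. Y i \<omega>) \<partial>Q)"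
      by blast+
  qed
  \<comment> \<open>\<open>F L\<close> lives on the torus, and \<open>G L\<close> is its pullback to Euclidean space.\<close>
  define F where "F L w = f (\<lambda>i\<in>I. L * arcsin (Im (w i))) * (\<Prod>i\<in>I. max 0 (Re (w i)))"
    for L and w :: "'i \<Rightarrow> complex"
  define G where "G L x = f (\<lambda>i\<in>I. L * arcsin (sin (x i / L))) * (\<Prod>i\<in>I. max 0 (cos (x i / L)))"
    for L and x :: "'i \<Rightarrow> real"
  have GF: "G L x = F L (\<lambda>i\<in>I. cis (x i / L))" for L x
    unfolding G_def F_def
    by (intro arg_cong2[where f = "(*)"] arg_cong[where f = f] prod.cong) auto
  have restrict_cont: "continuous_on S (\<lambda>w. \<lambda>i\<in>I. h i w)"
    if "\<And>i. i \<in> I \<Longrightarrow> continuous_on S (h i)"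
    for S :: "'s::topological_space set" and h :: "'i \<Rightarrow> 's \<Rightarrow> real"
  proof (rule continuous_on_coordinatewise_then_product)
    show "continuous_on S (\<lambda>w. (\<lambda>i\<in>I. h i w) i)" for i
      using that by (cases "i \<in> I") auto
  qed
  have F_cont: "continuous_on (PiE I (\<lambda>_. sphere 0 1)) (F L)" for L
  proof -
    have "\<bar>Im (w i)\<bar> \<le> 1" if "w \<in> PiE I (\<lambda>_. sphere 0 1)" "i \<in> I" for w :: "'i \<Rightarrow> complex" and i
      using that abs_Im_le_cmod[of "w i"] by (auto dest!: PiE_mem)
    then show ?thesis
      unfolding F_def
      by (intro continuous_intros continuous_on_compose2[OF f(1)] restrict_cont
          continuous_on_product_coordinates[THEN continuous_on_subset]) (auto simp: abs_le_iff)
  qed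
  have G_cont: "continuous_on UNIV (G L)" if "L > 0" for L
  proof -
    have "continuous_on UNIV (\<lambda>x. \<lambda>i\<in>I. L * arcsin (sin (x i / L)))"
      using that by (intro restrict_cont) (auto intro!: continuous_intros)
    then show ?thesis
      using that unfolding G_def
      by (intro continuous_on_mult continuous_on_compose2[OF f(1)])
         (auto intro!: continuous_intros)
  qed
  have G_bound: "\<bar>G L x\<bar> \<le> 1" for L x
  proof -
    have "(\<Prod>i\<in>I. max 0 (cos (x i / L))) \<le> (\<Prod>i\<in>I. 1)"
      by (intro prod_mono) auto
    moreover have "0 \<le> (\<Prod>i\<in>I. max 0 (cos (x i / L)))"
      by (intro prod_nonneg) auto
    ultimately show ?thesis
      using f(2) by (simp add: G_def abs_mult mult_le_one)
  qed
  \<comment> \<open>The factor \<open>2\<close> covers the points outside the box of side \<open>2 * L\<close>: there the sum is at least \<open>1\<close>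
    and the two functions differ by at most \<open>2\<close>.\<close>
  define err where "err L x = 2 * (\<Sum>i\<in>I. min 1 ((x i / L)\<^sup>2))" for L and x :: "'i \<Rightarrow> real"
  have err: "\<bar>f (restrict x I) - G L x\<bar> \<le> err L x" if L: "L > 0" for L x
  proof (cases "\<forall>i\<in>I. \<bar>x i / L\<bar> \<le> 1")
    case True
    then have half: "- (pi / 2) \<le> x i / L" "x i / L \<le> pi / 2" if "i \<in> I" for i
      using bspec[OF True that] pi_gt3 by linarith+
    have "G L x = f (restrict x I) * (\<Prod>i\<in>I. cos (x i / L))"
      unfolding G_def
    proof (intro arg_cong2[where f = "(*)"] arg_cong[where f = f] prod.cong refl restrict_ext)
      fix i assume "i \<in> I"
      from half[OF this] show "L * arcsin (sin (x i / L)) = x i"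
        using L by (subst arcsin_sin) simp_all
      from half[OF \<open>i \<in> I\<close>] show "max 0 (cos (x i / L)) = cos (x i / L)"
        by (intro max_absorb2 cos_ge_zero)
    qed
    then have eq: "f (restrict x I) - G L x = f (restrict x I) * (1 - (\<Prod>i\<in>I. cos (x i / L)))"
      by (simp add: algebra_simps)
    have p: "(\<Prod>i\<in>I. cos (x i / L)) \<le> (\<Prod>i\<in>I. 1)"
      using half by (intro prod_mono conjI cos_ge_zero cos_le_one)
    have "\<bar>f (restrict x I) - G L x\<bar> = \<bar>f (restrict x I)\<bar> * (1 - (\<Prod>i\<in>I. cos (x i / L)))"
      using p by (simp add: eq abs_mult)
    also have "\<dots> \<le> 1 * (\<Sum>i\<in>I. (x i / L)\<^sup>2)"
      using f(2) p one_minus_prod_cos_le[OF I, of "\<lambda>i. x i / L"] True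
      by (intro mult_mono) auto
    also have "(\<Sum>i\<in>I. (x i / L)\<^sup>2) = (\<Sum>i\<in>I. min 1 ((x i / L)\<^sup>2))"
      using True by (intro sum.cong) (auto simp: abs_square_le_1)
    also have "1 * \<dots> \<le> err L x"
      using sum_nonneg[of I "\<lambda>i. min 1 ((x i / L)\<^sup>2)"] by (simp add: err_def)
    finally show ?thesis .
  next
    case False
    then obtain i where i: "i \<in> I" "\<bar>x i / L\<bar> > 1" by auto
    then have "1 < (x i / L)\<^sup>2"
      using one_less_power[of "\<bar>x i / L\<bar>" 2] by (simp only: power2_abs)
    then have "1 \<le> (\<Sum>i\<in>I. min 1 ((x i / L)\<^sup>2))"
      using member_le_sum[of i I "\<lambda>i. min 1 ((x i / L)\<^sup>2)"] I i by simp
    moreover have "\<bar>f (restrict x I) - G L x\<bar> \<le> \<bar>f (restrict x I)\<bar> + \<bar>G L x\<bar>"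
      by (rule abs_triangle_ineq4)
    ultimately show ?thesis
      using spec[OF f(2), of "restrict x I"] G_bound[of L x] unfolding err_def by linarith
  qed
  have int_cont: "integrable P (\<lambda>\<omega>. h (\<lambda>i\<in>I. W i \<omega>))"
    if "prob_space P" "\<And>i. i \<in> I \<Longrightarrow> W i \<in> borel_measurable P"
      "continuous_on UNIV h" "\<And>x. \<bar>h x\<bar> \<le> B"
    for P :: "'c measure" and W :: "'i \<Rightarrow> 'c \<Rightarrow> real" and h :: "('i \<Rightarrow> real) \<Rightarrow> real" and B
  proof -
    interpret P: prob_space P by fact
    have "(\<lambda>\<omega>. h (\<lambda>i\<in>I. W i \<omega>)) \<in> borel_measurable P"
      using measurable_restrict_function[OF that(2)] borel_measurable_continuous_onI[OF that(3)]
      by (rule measurable_compose)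
    then show ?thesis
      using that(4) by (intro P.integrable_const_bound[where B = B]) auto
  qed
  have G_conv: "(\<lambda>n. \<integral>\<omega>. G L (\<lambda>i\<in>I. V n i \<omega>) \<partial>M) \<longlonglongrightarrow> (\<integral>\<omega>. G L (\<lambda>i\<in>I. Y i \<omega>) \<partial>Q)"
    if L: "L > 0" for L
  proof -
    have "\<exists>p. trig_poly I p \<and> (\<forall>x. \<bar>G L x - p x\<bar> \<le> 1 / real (Suc k))" for k
      using trig_poly_dense[OF I F_cont, of "1 / real (Suc k)" L L] unfolding GF
      by (metis less_imp_le of_nat_0_less_iff zero_less_Suc zero_less_divide_1_iff)
    then obtain p where p: "\<And>k. trig_poly I (p k)"
      "\<And>k x. \<bar>G L x - p k x\<bar> \<le> 1 / real (Suc k)"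
      by metis
    show ?thesis
    proof (rule tendsto_if_approximable)
      show "(\<lambda>n. \<integral>\<omega>. p k (\<lambda>i\<in>I. V n i \<omega>) \<partial>M) \<longlonglongrightarrow> (\<integral>\<omega>. p k (\<lambda>i\<in>I. Y i \<omega>) \<partial>Q)" for k
        by (rule trig(3)[OF p(1)])
      show "(\<lambda>n. 1 / real (Suc k)) \<longlonglongrightarrow> 1 / real (Suc k)" for k
        by simp
      show "\<bar>(\<integral>\<omega>. G L (\<lambda>i\<in>I. V n i \<omega>) \<partial>M) - (\<integral>\<omega>. p k (\<lambda>i\<in>I. V n i \<omega>) \<partial>M)\<bar> \<le> 1 / real (Suc k)" for k n
      proof -
        have "\<bar>(\<integral>\<omega>. G L (\<lambda>i\<in>I. V n i \<omega>) \<partial>M) - (\<integral>\<omega>. p k (\<lambda>i\<in>I. V n i \<omega>) \<partial>M)\<bar> \<le> (\<integral>\<omega>. 1 / real (Suc k) \<partial>M)"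
          by (intro abs_integral_diff_le int_cont[OF M V G_cont[OF L] G_bound] trig(1)[OF p(1)] p(2) M.integrable_const)
        then show ?thesis by (simp add: M.prob_space)
      qed
      show "\<bar>(\<integral>\<omega>. G L (\<lambda>i\<in>I. Y i \<omega>) \<partial>Q) - (\<integral>\<omega>. p k (\<lambda>i\<in>I. Y i \<omega>) \<partial>Q)\<bar> \<le> 1 / real (Suc k)" for k
      proof -
        have "\<bar>(\<integral>\<omega>. G L (\<lambda>i\<in>I. Y i \<omega>) \<partial>Q) - (\<integral>\<omega>. p k (\<lambda>i\<in>I. Y i \<omega>) \<partial>Q)\<bar> \<le> (\<integral>\<omega>. 1 / real (Suc k) \<partial>Q)"
          by (intro abs_integral_diff_le int_cont[OF Q Y G_cont[OF L] G_bound] trig(2)[OF p(1)] p(2) Q.integrable_const)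
        then show ?thesis by (simp add: Q.prob_space)
      qed
      show "(\<lambda>k. 1 / real (Suc k)) \<longlonglongrightarrow> 0"
        using LIMSEQ_inverse_real_of_nat by (simp add: inverse_eq_divide)
    qed
  qed
  have err_cont: "continuous_on UNIV (err L)" if "L > 0" for L
    using that unfolding err_def by (auto intro!: continuous_intros)
  have err_bound: "\<bar>err L x\<bar> \<le> 2 * real (card I)" for L x
  proof -
    have "(\<Sum>i\<in>I. min 1 ((x i / L)\<^sup>2)) \<le> (\<Sum>i\<in>I. 1)"
      by (intro sum_mono) auto
    moreover have "0 \<le> (\<Sum>i\<in>I. min 1 ((x i / L)\<^sup>2))"
      by (intro sum_nonneg) auto
    ultimately show ?thesis by (simp add: err_def)
  qed
  have f_cut: "\<bar>f (\<lambda>i\<in>I. W i) - G L (\<lambda>i\<in>I. W i)\<bar> \<le> err L (\<lambda>i\<in>I. W i)" if "L > 0" for L W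
    using err[OF that, of "\<lambda>i\<in>I. W i"] by simp
  show "(\<lambda>n. \<integral>\<omega>. f (\<lambda>i\<in>I. V n i \<omega>) \<partial>M) \<longlonglongrightarrow> (\<integral>\<omega>. f (\<lambda>i\<in>I. Y i \<omega>) \<partial>Q)"
  proof (rule tendsto_if_approximable)
    show "(\<lambda>n. \<integral>\<omega>. G (real (Suc k)) (\<lambda>i\<in>I. V n i \<omega>) \<partial>M)
        \<longlonglongrightarrow> (\<integral>\<omega>. G (real (Suc k)) (\<lambda>i\<in>I. Y i \<omega>) \<partial>Q)" for k
      by (rule G_conv) simp
    show "(\<lambda>n. \<integral>\<omega>. err (real (Suc k)) (\<lambda>i\<in>I. V n i \<omega>) \<partial>M)
        \<longlonglongrightarrow> (\<integral>\<omega>. err (real (Suc k)) (\<lambda>i\<in>I. Y i \<omega>) \<partial>Q)" for k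
    proof -
      \<comment> \<open>One-dimensional convergence of the coordinates is the case of unit coefficient vectors.\<close>
      let ?c = "\<lambda>y::real. min 1 ((y / real (Suc k))\<^sup>2)"
      have one: "tends_in_law M (\<lambda>n. V n i) Q (Y i)" if "i \<in> I" for i
        using lin[of "\<lambda>j. of_bool (j = i)"] I that by (simp add: sum.remove[of I i])
      have c: "(\<lambda>n. \<integral>\<omega>. ?c (V n i \<omega>) \<partial>M) \<longlonglongrightarrow> (\<integral>\<omega>. ?c (Y i \<omega>) \<partial>Q)" if "i \<in> I" for i
        by (rule tends_in_lawD[OF one[OF that]]) (auto intro!: continuous_intros)
      have int: "integrable P (\<lambda>\<omega>. ?c (W \<omega>))"
        if "prob_space P" and [measurable]: "W \<in> borel_measurable P" for P :: "'c measure" and W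
      proof -
        interpret P: prob_space P by fact
        show ?thesis by (rule P.integrable_const_bound[where B = 1]) auto
      qed
      show ?thesis
        using int[OF M V] int[OF Q Y] c by (auto simp: err_def intro!: tendsto_intros)
    qed
    show "\<bar>(\<integral>\<omega>. f (\<lambda>i\<in>I. V n i \<omega>) \<partial>M) - (\<integral>\<omega>. G (real (Suc k)) (\<lambda>i\<in>I. V n i \<omega>) \<partial>M)\<bar>
        \<le> (\<integral>\<omega>. err (real (Suc k)) (\<lambda>i\<in>I. V n i \<omega>) \<partial>M)" for k n
      by (intro abs_integral_diff_le int_cont[OF M V f(1) spec[OF f(2)]] int_cont[OF M V G_cont G_bound]
          int_cont[OF M V err_cont err_bound] f_cut) simp_all
    show "\<bar>(\<integral>\<omega>. f (\<lambda>i\<in>I. Y i \<omega>) \<partial>Q) - (\<integral>\<omega>. G (real (Suc k)) (\<lambda>i\<in>I. Y i \<omega>) \<partial>Q)\<bar>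
        \<le> (\<integral>\<omega>. err (real (Suc k)) (\<lambda>i\<in>I. Y i \<omega>) \<partial>Q)" for k
      by (intro abs_integral_diff_le int_cont[OF Q Y f(1) spec[OF f(2)]] int_cont[OF Q Y G_cont G_bound]
          int_cont[OF Q Y err_cont err_bound] f_cut) simp_all
    have "(\<lambda>k. \<integral>\<omega>. err (real (Suc k)) (\<lambda>i\<in>I. Y i \<omega>) \<partial>Q) \<longlonglongrightarrow> (\<integral>\<omega>. 0 \<partial>Q)"
    proof (rule integral_dominated_convergence[where w = "\<lambda>_. 2 * real (card I)"])
      show "(\<lambda>\<omega>. err (real (Suc k)) (\<lambda>i\<in>I. Y i \<omega>)) \<in> borel_measurable Q" for k
        by (intro borel_measurable_integrable int_cont[OF Q Y err_cont err_bound]) simp_all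
      have "(\<lambda>k. err (real (Suc k)) x) \<longlonglongrightarrow> 2 * (\<Sum>i\<in>I. min 1 (0\<^sup>2))" for x
      proof -
        have "(\<lambda>k. c / real (Suc k)) \<longlonglongrightarrow> 0" for c
          using tendsto_mult_left[OF LIMSEQ_inverse_real_of_nat, of c] by (simp add: field_simps)
        then show ?thesis
          unfolding err_def by (intro tendsto_intros)
      qed
      then show "AE \<omega> in Q. (\<lambda>k. err (real (Suc k)) (\<lambda>i\<in>I. Y i \<omega>)) \<longlonglongrightarrow> 0"
        by simp
      show "AE \<omega> in Q. norm (err (real (Suc k)) (\<lambda>i\<in>I. Y i \<omega>)) \<le> 2 * real (card I)" for k
        using err_bound by simp
    qed simp_all
    then show "(\<lambda>k. \<integral>\<omega>. err (real (Suc k)) (\<lambda>i\<in>I. Y i \<omega>) \<partial>Q) \<longlonglongrightarrow> 0"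
      by simp
  qed
qed

section \<open>The univariate central limit theorem with a possibly degenerate limit\<close>

lemma normal_law_moments:
  assumes "0 \<le> s"
  shows "integrable (normal_law m s) (\<lambda>x. x\<^sup>2)"
    and "(\<integral>x. x \<partial>normal_law m s) = m"
    and "(\<integral>x. (x - m)\<^sup>2 \<partial>normal_law m s) = s\<^sup>2"
proof -
  have "integrable (normal_law m s) (\<lambda>x. x\<^sup>2) \<and> (\<integral>x. x \<partial>normal_law m s) = m \<and>
    (\<integral>x. (x - m)\<^sup>2 \<partial>normal_law m s) = s\<^sup>2"
  proof (cases "s = 0")
    case True
    have "integrable (return borel m) (\<lambda>x. x\<^sup>2)"
      by (rule integrableI_bounded) (auto simp: nn_integral_return)
    then show ?thesis
      using True by (simp add: normal_law_def integral_return)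
  next
    case False
    with assms have s: "0 < s" by simp
    have "integrable lborel (\<lambda>x. normal_density m s x * (x - m)\<^sup>2)"
      by (rule integrable_normal_moment[OF s])
    moreover have "integrable lborel (\<lambda>x. normal_density m s x * x)"
      by (rule integrable_normal_moment_nz_1[OF s])
    moreover have "integrable lborel (\<lambda>x. normal_density m s x)"
      by (rule integrable_normal_density[OF s])
    ultimately have "integrable lborel (\<lambda>x. normal_density m s x * (x - m)\<^sup>2
        + 2 * m * (normal_density m s x * x) - m\<^sup>2 * normal_density m s x)"
      by (intro Bochner_Integration.integrable_add Bochner_Integration.integrable_diff integrable_mult_right)
    then have "integrable lborel (\<lambda>x. normal_density m s x * x\<^sup>2)"
      by (rule Bochner_Integration.integrable_cong[THEN iffD1, rotated -1])
         (simp_all add: power2_eq_square algebra_simps)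
    moreover have "(\<integral>x. normal_density m s x * (x - m)\<^sup>2 \<partial>lborel) = s\<^sup>2"
      using integral_normal_moment_even[OF s, of m 1] by (simp add: fact_numeral)
    moreover have "(\<integral>x. normal_density m s x * x \<partial>lborel) = m"
      by (rule integral_normal_moment_nz_1[OF s])
    ultimately show ?thesis
      using s by (simp add: normal_law_def integrable_density integral_density)
  qed
  then show "integrable (normal_law m s) (\<lambda>x. x\<^sup>2)"
    and "(\<integral>x. x \<partial>normal_law m s) = m"
    and "(\<integral>x. (x - m)\<^sup>2 \<partial>normal_law m s) = s\<^sup>2"
    by blast+
qed

lemma (in prob_space)
  assumes "0 \<le> s" and [measurable]: "Y \<in> borel_measurable M"
    and Y: "distr M borel Y = normal_law m s"
  shows normal_law_square_integrable: "integrable M (\<lambda>\<omega>. (Y \<omega>)\<^sup>2)"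
    and normal_law_expectation: "expectation Y = m"
    and normal_law_variance: "variance Y = s\<^sup>2"
proof -
  show "integrable M (\<lambda>\<omega>. (Y \<omega>)\<^sup>2)"
    using normal_law_moments(1)[OF assms(1), of m]
    by (simp add: Y[symmetric] integrable_distr_eq)
  show E: "expectation Y = m"
    using normal_law_moments(2)[OF assms(1), of m]
    by (simp add: Y[symmetric] integral_distr)
  show "variance Y = s\<^sup>2"
    using normal_law_moments(3)[OF assms(1), of m]
    by (simp add: Y[symmetric] integral_distr E)
qed

lemma (in prob_space) normal_law_AE_nonzero:
  assumes "0 < s" and [measurable]: "Y \<in> borel_measurable M"
    and Y: "distr M borel Y = normal_law m s"
  shows "AE \<omega> in M. Y \<omega> \<noteq> 0"
proof -
  have law: "normal_law m s = density lborel (\<lambda>x. ennreal (normal_density m s x))"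
    using assms(1) by (simp add: normal_law_def)
  have "AE x in lborel. x \<noteq> (0::real)"
    by (rule AE_lborel_singleton)
  then have "AE x in normal_law m s. x \<noteq> 0"
    unfolding law by (subst AE_density) auto
  then show ?thesis
    unfolding Y[symmetric] by (subst (asm) AE_distr_iff) auto
qed

text \<open>
  The classical theorem requires a positive variance. For \<open>s = 0\<close> the summands vanish almost surely, which
  matches the point mass \<^term>\<open>normal_law 0 0\<close>; this case is needed because linear combinations of
  the coordinates of a singular normal vector can be degenerate.
\<close>

lemma (in prob_space) central_limit_theorem_normal_law:
  assumes indep: "indep_vars (\<lambda>_. borel) \<xi> UNIV"
    and ident: "\<And>n. distr M borel (\<xi> n) = distr M borel (\<xi> 0)"
    and mean: "\<And>n. expectation (\<xi> n) = 0"
    and sq: "\<And>n. integrable M (\<lambda>\<omega>. (\<xi> n \<omega>)\<^sup>2)"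
    and var: "\<And>n. variance (\<xi> n) = s\<^sup>2" and "0 \<le> s"
    and Q: "prob_space Q" and [measurable]: "Y \<in> borel_measurable Q"
    and Y: "distr Q borel Y = normal_law 0 s"
  shows "tends_in_law M (\<lambda>n \<omega>. (\<Sum>i<n. \<xi> i \<omega>) / sqrt (real n)) Q Y"
proof -
  interpret Q: prob_space Q by fact
  have [measurable]: "\<xi> n \<in> borel_measurable M" for n
    using indep by (simp add: indep_vars_def2)
  show ?thesis
    unfolding tends_in_law_def
  proof (intro allI impI)
    fix f :: "real \<Rightarrow> real" assume f: "continuous_on UNIV f" "\<forall>x. \<bar>f x\<bar> \<le> 1"
    then have [measurable]: "f \<in> borel_measurable borel"
      by (auto intro: borel_measurable_continuous_onI)
    have Yf: "(\<integral>\<omega>. f (Y \<omega>) \<partial>Q) = (\<integral>x. f x \<partial>normal_law 0 s)"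
      by (simp add: Y[symmetric] integral_distr)
    show "(\<lambda>n. \<integral>\<omega>. f ((\<Sum>i<n. \<xi> i \<omega>) / sqrt (real n)) \<partial>M) \<longlonglongrightarrow> (\<integral>\<omega>. f (Y \<omega>) \<partial>Q)"
    proof (cases "s = 0")
      case True
      have "AE \<omega> in M. \<xi> n \<omega> = 0" for n
      proof -
        have "AE \<omega> in M. (\<xi> n \<omega>)\<^sup>2 = 0"
          using var[of n] mean[of n] sq[of n] True
          by (subst integral_nonneg_eq_0_iff_AE[symmetric]) auto
        then show ?thesis by simp
      qed
      then have "AE \<omega> in M. \<forall>n. \<xi> n \<omega> = 0"
        by (simp add: AE_all_countable)
      then have "(\<integral>\<omega>. f ((\<Sum>i<n. \<xi> i \<omega>) / sqrt (real n)) \<partial>M) = (\<integral>\<omega>. f 0 \<partial>M)" for n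
        by (intro integral_cong_AE) auto
      moreover have "(\<integral>x. f x \<partial>normal_law 0 s) = f 0"
        using True by (simp add: normal_law_def integral_return)
      ultimately show ?thesis
        by (simp add: Yf prob_space)
    next
      case False
      with \<open>0 \<le> s\<close> have s: "0 < s" by simp
      let ?Z = "\<lambda>n \<omega>. (\<Sum>i<n. \<xi> i \<omega> - 0) / sqrt (real n * s\<^sup>2)"
      have "weak_conv_m (\<lambda>n. distr M borel (?Z n)) std_normal_distribution"
        by (rule central_limit_theorem[OF indep mean s sq var ident])
      then have "weak_conv_m (\<lambda>n. distr M borel (?Z n)) (distr Q borel (\<lambda>\<omega>. Y \<omega> / s))"
      proof -
        have "distributed Q lborel Y (normal_density 0 s)"
          unfolding distributed_def
          using Y s by (auto simp: normal_law_def cong: distr_cong)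
        then have "distributed Q lborel (\<lambda>\<omega>. (Y \<omega> - 0) / s) std_normal_density"
          using Q.normal_standard_normal_convert[OF s] by blast
        then have "distr Q borel (\<lambda>\<omega>. Y \<omega> / s) = std_normal_distribution"
          unfolding distributed_def by (auto cong: distr_cong)
        then show ?thesis
          using \<open>weak_conv_m _ _\<close> by simp
      qed
      then have "tends_in_law M ?Z Q (\<lambda>\<omega>. Y \<omega> / s)"
        by (intro weak_conv_m_imp_tends_in_law Q prob_space_axioms) auto
      then have "tends_in_law M (\<lambda>n \<omega>. s * ?Z n \<omega>) Q (\<lambda>\<omega>. s * (Y \<omega> / s))"
        by (rule tends_in_law_continuous_image) (intro continuous_intros)
      moreover have "s * ?Z n \<omega> = (\<Sum>i<n. \<xi> i \<omega>) / sqrt (real n)" for n \<omega>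
        using s by (simp add: real_sqrt_mult)
      ultimately show ?thesis
        using s f by (auto dest: tends_in_lawD)
    qed
  qed
qed

lemma (in prob_space) indep_vars_reindex:
  assumes "indep_vars M' X (f ` I)" "inj_on f I"
  shows "indep_vars (\<lambda>i. M' (f i)) (\<lambda>i. X (f i)) I"
  unfolding indep_vars_def2 indep_sets_def
proof (intro conjI ballI allI impI)
  fix i assume "i \<in> I"
  then show "random_variable (M' (f i)) (X (f i))"
    using assms(1) by (simp add: indep_vars_def2)
  then show "{X (f i) -` A \<inter> space M |A. A \<in> sets (M' (f i))} \<subseteq> events"
    by (auto intro: measurable_sets)
next
  fix J A
  assume J: "J \<subseteq> I" "J \<noteq> {}" "finite J"
    and A: "A \<in> (\<Pi> i\<in>J. {X (f i) -` A \<inter> space M |A. A \<in> sets (M' (f i))})"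
  have inj: "inj_on f J" using assms(2) J(1) by (rule inj_on_subset)
  let ?A = "\<lambda>j. A (the_inv_into J f j)"
  have A_eq: "?A (f j) = A j" if "j \<in> J" for j
    using that inj by (simp add: the_inv_into_f_f)
  have "prob (\<Inter>j\<in>f ` J. ?A j) = (\<Prod>j\<in>f ` J. prob (?A j))"
  proof (rule indep_setsD)
    show "indep_sets (\<lambda>i. {X i -` A \<inter> space M |A. A \<in> sets (M' i)}) (f ` I)"
      using assms(1) by (simp add: indep_vars_def2)
    show "\<forall>j\<in>f ` J. ?A j \<in> {X j -` A \<inter> space M |A. A \<in> sets (M' j)}"
      using A A_eq by (auto dest: funcset_mem)
  qed (use J in auto)
  then show "prob (\<Inter>j\<in>J. A j) = (\<Prod>j\<in>J. prob (A j))"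
    using A_eq inj by (simp add: prod.reindex)
qed

section \<open>The ratio statistic as a function of partial sums\<close>

lemma continuous_on_Max_image:
  fixes f :: "'i \<Rightarrow> 's::topological_space \<Rightarrow> real"
  assumes "finite I" "I \<noteq> {}" "\<And>i. i \<in> I \<Longrightarrow> continuous_on S (f i)"
  shows "continuous_on S (\<lambda>x. MAX i\<in>I. f i x)"
  using assms
proof (induction rule: finite_ne_induct)
  case (insert i I)
  then have "continuous_on S (\<lambda>x. max (f i x) (MAX i\<in>I. f i x))"
    by (intro continuous_on_max) auto
  then show ?case
    using insert.hyps by simp
qed simp

lemma Max_image_mult:
  fixes f :: "'i \<Rightarrow> real"
  assumes "finite I" "I \<noteq> {}" "0 \<le> c"
  shows "(MAX i\<in>I. c * f i) = c * (MAX i\<in>I. f i)"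
proof -
  have "mono (\<lambda>x. c * x)"
    using assms(3) by (intro monoI mult_left_mono)
  from mono_Max_commute[OF this, of "f ` I"] assms show ?thesis
    by (simp add: image_image)
qed

lemma ratio_of_scaled_maxima:
  fixes f :: "'i \<Rightarrow> real" and g :: "'j \<Rightarrow> real"
  assumes "finite A" "A \<noteq> {}" "finite B" "B \<noteq> {}" "c > 0"
  shows "(MAX i\<in>A. c * f i) / (MAX j\<in>B. c * g j) = (MAX i\<in>A. f i) / (MAX j\<in>B. g j)"
  using assms by (simp add: Max_image_mult)

text \<open>
  Scale invariance absorbs both the unknown \<open>\<sigma>\<close> and the normalisation \<open>1 / sqrt N\<close> of the central
  limit theorem.
\<close>

lemma ratio_limit_scale:
  assumes "T \<ge> 4" "c > 0"
  shows "ratio_limit T (\<lambda>t. c * x t) = ratio_limit T x"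
proof -
  have num: "\<bar>c * x s - real s / real t * (c * x t)\<bar> = c * \<bar>x s - real s / real t * x t\<bar>" for s t
  proof -
    have "c * x s - real s / real t * (c * x t) = c * (x s - real s / real t * x t)"
      by (simp add: algebra_simps)
    then show ?thesis using assms(2) by (simp only: abs_mult)
  qed
  have den: "\<bar>c * x T - c * x s - (real T - real s) / (real T - real t) * (c * x T - c * x t)\<bar> =
      c * \<bar>x T - x s - (real T - real s) / (real T - real t) * (x T - x t)\<bar>" for s t
  proof -
    have "c * x T - c * x s - (real T - real s) / (real T - real t) * (c * x T - c * x t) =
        c * (x T - x s - (real T - real s) / (real T - real t) * (x T - x t))"
      by (simp add: algebra_simps)
    then show ?thesis using assms(2) by (simp only: abs_mult)
  qed
  show ?thesis
    unfolding ratio_limit_def Let_def num den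
    using assms by (intro arg_cong[where f = Max] image_cong refl ratio_of_scaled_maxima) auto
qed

lemma ratio_limit_cong:
  assumes "T \<ge> 4" "\<And>t. t \<in> {1..T} \<Longrightarrow> x t = y t"
  shows "ratio_limit T x = ratio_limit T y"
proof -
  have "x T = y T" using assms by simp
  moreover have "x t = y t" if "t \<in> {2..T-2}" for t using assms that by auto
  moreover have "x s = y s" if "t \<in> {2..T-2}" "s \<in> {1..t}" for s t using assms that by auto
  moreover have "x s = y s" if "t \<in> {2..T-2}" "s \<in> {t..T-1}" for s t using assms that by auto
  ultimately show ?thesis
    unfolding ratio_limit_def Let_def
    by (intro arg_cong[where f = Max] image_cong refl arg_cong2[where f = "(/)"]) auto
qed

text \<open>
  Along a linear function all numerators vanish, and a quotient with numerator \<open>0\<close> is \<open>0\<close> whatever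
  its denominator is.
\<close>

lemma ratio_limit_linear:
  assumes T: "T \<ge> 4" and x: "\<And>t. t \<in> {1..T} \<Longrightarrow> x t = real t * a"
  shows "ratio_limit T x = 0"
proof -
  have "ratio_limit T x = ratio_limit T (\<lambda>t. real t * a)"
    using assms by (rule ratio_limit_cong)
  also have "\<dots> = (MAX t\<in>{2..T-2}. 0)"
    unfolding ratio_limit_def Let_def
  proof (intro arg_cong[where f = Max] image_cong refl)
    fix t assume t: "t \<in> {2..T-2}"
    then have "(MAX s\<in>{1..t}. \<bar>real s * a - real s / real t * (real t * a)\<bar>) = (MAX s\<in>{1..t}. 0)"
      by (intro arg_cong[where f = Max] image_cong refl) auto
    also have "\<dots> = 0" using t by simp
    finally show "(MAX s\<in>{1..t}. \<bar>real s * a - real s / real t * (real t * a)\<bar>) /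
      (MAX s\<in>{t..T-1}. \<bar>real T * a - real s * a - (real T - real s) / (real T - real t) *
        (real T * a - real t * a)\<bar>) = 0" by simp
  qed
  also have "\<dots> = 0" using T by simp
  finally show ?thesis .
qed

text \<open>
  One linear form controls all denominators at once. As \<open>t \<le> T - 2\<close>, each maximum includes the terms
  \<open>s = T - 1\<close> and \<open>s = T - 2\<close>; if both vanish, then the last two increments of \<open>x\<close> agree, that is, its
  second difference at the end is \<open>0\<close>.
\<close>

lemma continuous_on_ratio_limit:
  assumes T: "T \<ge> 4"
  shows "continuous_on {x. x T - 2 * x (T - 1) + x (T - 2) \<noteq> 0} (ratio_limit T)"
proof -
  let ?S = "{x. x T - 2 * x (T - 1) + x (T - 2) \<noteq> 0} :: (nat \<Rightarrow> real) set"
  let ?z = "\<lambda>s t x. \<bar>x T - x s - (real T - real s) / (real T - real t) * (x T - x t)\<bar>"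
  have coord: "continuous_on ?S (\<lambda>x. x t)" for t
    by (rule continuous_on_subset[OF continuous_on_product_coordinates]) simp
  have "(MAX s\<in>{t..T-1}. ?z s t x) \<noteq> 0" if x: "x \<in> ?S" and t: "t \<in> {2..T-2}" for x t
  proof
    assume 0: "(MAX s\<in>{t..T-1}. ?z s t x) = 0"
    have z: "?z s t x = 0" if "s \<in> {t..T-1}" for s
    proof -
      have "?z s t x \<le> (MAX s\<in>{t..T-1}. ?z s t x)"
        using that by (intro Max_ge) auto
      with 0 show ?thesis by simp
    qed
    have "T - 1 \<in> {t..T-1}" "T - 2 \<in> {t..T-1}" "real (T - 1) = real T - 1" "real (T - 2) = real T - 2"
      using t T by auto
    from z[OF this(1)] z[OF this(2)] this(3,4)
    have "x T - x (T - 1) = (x T - x t) / (real T - real t)"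
      and "x T - x (T - 2) = 2 * ((x T - x t) / (real T - real t))"
      by simp_all
    then have "x T - 2 * x (T - 1) + x (T - 2) = 0"
      by linarith
    with x show False by simp
  qed
  then show ?thesis
    unfolding ratio_limit_def[abs_def] Let_def using T
    by (intro continuous_on_Max_image continuous_on_divide continuous_intros coord) auto
qed

lemma measurable_ratio_limit: "ratio_limit T \<in> borel_measurable borel"
proof -
  have [measurable]: "(\<lambda>x. x t) \<in> borel_measurable borel" for t :: nat
    by (rule borel_measurable_continuous_onI[OF continuous_on_product_coordinates])
  show ?thesis
    unfolding ratio_limit_def[abs_def] Let_def by measurable
qed

text \<open>
  Centring removes the panel means \<open>\<mu> i\<close>, and the remaining factor \<open>\<sigma>\<close> cancels. So the statistic is
  the limit functional itself, evaluated at the partial sums of the errors over all panels.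
\<close>

lemma ratio_stat_no_change:
  assumes T: "T \<ge> 4" and \<sigma>: "\<sigma> > 0"
  shows "ratio_stat T N (\<lambda>i t. panel_obs \<mu> \<delta> \<sigma> T \<epsilon> i t \<omega>) =
    ratio_limit T (\<lambda>t. \<Sum>i=1..N. \<Sum>s=1..t. \<epsilon> i s \<omega>)"
proof -
  define Y where "Y i t = panel_obs \<mu> \<delta> \<sigma> T \<epsilon> i t \<omega>" for i t
  define E where "E i t = (\<Sum>s=1..t. \<epsilon> i s \<omega>)" for i t
  define W where "W t = (\<Sum>i=1..N. E i t)" for t
  have sumY: "(\<Sum>r=1..s. Y i r) = real s * \<mu> i + \<sigma> * E i s" if "s \<le> T" for i s
    using that unfolding Y_def E_def panel_obs_def sum_distrib_left
    by (simp add: sum.distrib)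
  have tailY: "(\<Sum>r=s+1..T. Y i r) = (real T - real s) * \<mu> i + \<sigma> * (E i T - E i s)" if "s \<le> T" for i s
  proof -
    have "(\<Sum>r=1..T. Y i r) = (\<Sum>r=1..s. Y i r) + (\<Sum>r=s+1..T. Y i r)"
      using that sum.ub_add_nat[of 1 s "Y i" "T - s"] by simp
    then show ?thesis
      using sumY[of T] sumY[OF that] by (simp add: algebra_simps)
  qed
  have total: "(\<Sum>i=1..N. \<sigma> * (a i - k * b i)) = \<sigma> * ((\<Sum>i=1..N. a i) - k * (\<Sum>i=1..N. b i))"
    for a b k
    by (simp add: sum_subtractf flip: sum_distrib_left)
  have num: "\<bar>\<Sum>i=1..N. \<Sum>r=1..s. (Y i r - mean_before Y i t)\<bar> =
      \<sigma> * \<bar>W s - real s / real t * W t\<bar>" if "t \<in> {2..T-2}" "s \<in> {1..t}" for s t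
  proof -
    have "(\<Sum>r=1..s. (Y i r - mean_before Y i t)) = \<sigma> * (E i s - real s / real t * E i t)" for i
    proof -
      have "(\<Sum>r=1..s. (Y i r - mean_before Y i t)) = (\<Sum>r=1..s. Y i r) - real s * mean_before Y i t"
        by (simp add: sum_subtractf)
      also have "\<dots> = \<sigma> * (E i s - real s / real t * E i t)"
        using that T unfolding mean_before_def by (subst (1 2) sumY) (auto simp: field_simps)
      finally show ?thesis .
    qed
    then have "(\<Sum>i=1..N. \<Sum>r=1..s. (Y i r - mean_before Y i t)) = \<sigma> * (W s - real s / real t * W t)"
      by (simp only: W_def total)
    then show ?thesis using \<sigma> by (simp add: abs_mult)
  qed
  have den: "\<bar>\<Sum>i=1..N. \<Sum>r=s+1..T. (Y i r - mean_after T Y i t)\<bar> =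
      \<sigma> * \<bar>W T - W s - (real T - real s) / (real T - real t) * (W T - W t)\<bar>"
    if "t \<in> {2..T-2}" "s \<in> {t..T-1}" for s t
  proof -
    have "(\<Sum>r=s+1..T. (Y i r - mean_after T Y i t)) =
      \<sigma> * (E i T - E i s - (real T - real s) / (real T - real t) * (E i T - E i t))" for i
    proof -
      have "(\<Sum>r=s+1..T. (Y i r - mean_after T Y i t)) =
          (\<Sum>r=s+1..T. Y i r) - (real T - real s) * mean_after T Y i t"
      proof -
        have "real (T - s) = real T - real s" using that by auto
        then show ?thesis by (simp add: sum_subtractf)
      qed
      also have "\<dots> = \<sigma> * (E i T - E i s - (real T - real s) / (real T - real t) * (E i T - E i t))"
      proof -
        have "real T - real t \<noteq> 0" using that T by auto
        moreover have "s \<le> T" "t \<le> T" using that by auto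
        ultimately show ?thesis
          unfolding mean_after_def by (simp only: tailY) (simp add: field_simps)
      qed
      finally show ?thesis .
    qed
    then have "(\<Sum>i=1..N. \<Sum>r=s+1..T. (Y i r - mean_after T Y i t)) =
        \<sigma> * (W T - W s - (real T - real s) / (real T - real t) * (W T - W t))"
      by (simp only: W_def total sum_subtractf)
    then show ?thesis using \<sigma> by (simp add: abs_mult)
  qed
  have "ratio_stat T N Y = ratio_limit T W"
    unfolding ratio_stat_def ratio_limit_def Let_def
  proof (intro arg_cong[where f = Max] image_cong refl)
    fix t assume t: "t \<in> {2..T-2}"
    have "(MAX s\<in>{1..t}. \<bar>\<Sum>i=1..N. \<Sum>r=1..s. (Y i r - mean_before Y i t)\<bar>) =
        (MAX s\<in>{1..t}. \<sigma> * \<bar>W s - real s / real t * W t\<bar>)"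
      using t by (intro arg_cong[where f = Max] image_cong refl num)
    moreover have "(MAX s\<in>{t..T-1}. \<bar>\<Sum>i=1..N. \<Sum>r=s+1..T. (Y i r - mean_after T Y i t)\<bar>) =
        (MAX s\<in>{t..T-1}. \<sigma> * \<bar>W T - W s - (real T - real s) / (real T - real t) * (W T - W t)\<bar>)"
      using t by (intro arg_cong[where f = Max] image_cong refl den)
    ultimately show "(MAX s\<in>{1..t}. \<bar>\<Sum>i=1..N. \<Sum>r=1..s. (Y i r - mean_before Y i t)\<bar>) /
        (MAX s\<in>{t..T-1}. \<bar>\<Sum>i=1..N. \<Sum>r=s+1..T. (Y i r - mean_after T Y i t)\<bar>) =
        (MAX s\<in>{1..t}. \<bar>W s - real s / real t * W t\<bar>) /
        (MAX s\<in>{t..T-1}. \<bar>W T - W s - (real T - real s) / (real T - real t) * (W T - W t)\<bar>)"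
      using t T \<sigma> by (simp only:) (intro ratio_of_scaled_maxima; auto)
  qed
  then show ?thesis
    by (simp add: Y_def[abs_def] W_def[abs_def] E_def)
qed

section \<open>Partial sums of the panel errors\<close>

lemma (in prob_space) variance_linear_combination:
  assumes "finite I" "\<And>t. t \<in> I \<Longrightarrow> integrable M (X t)" "\<And>t. t \<in> I \<Longrightarrow> expectation (X t) = 0"
    and prod: "\<And>t v. t \<in> I \<Longrightarrow> v \<in> I \<Longrightarrow> integrable M (\<lambda>\<omega>. X t \<omega> * X v \<omega>)"
  shows "variance (\<lambda>\<omega>. \<Sum>t\<in>I. a t * X t \<omega>) = (\<Sum>t\<in>I. \<Sum>v\<in>I. a t * a v * covariance (X t) (X v))"
proof -
  have "variance (\<lambda>\<omega>. \<Sum>t\<in>I. a t * X t \<omega>) =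
      covariance (\<lambda>\<omega>. \<Sum>t\<in>I. a t * X t \<omega>) (\<lambda>\<omega>. \<Sum>v\<in>I. a v * X v \<omega>)"
    by (simp add: covariance_def power2_eq_square)
  also have "\<dots> = (\<Sum>t\<in>I. \<Sum>v\<in>I. covariance (\<lambda>\<omega>. a t * X t \<omega>) (\<lambda>\<omega>. a v * X v \<omega>))"
  proof (rule covariance_sum)
    fix t v assume "t \<in> I" "v \<in> I"
    then have "integrable M (\<lambda>\<omega>. (a t * a v) * (X t \<omega> * X v \<omega>))"
      by (intro integrable_mult_right prod)
    then show "integrable M (\<lambda>\<omega>. a t * X t \<omega> * (a v * X v \<omega>))"
      by (simp add: ac_simps)
  qed (use assms in auto)
  also have "\<dots> = (\<Sum>t\<in>I. \<Sum>v\<in>I. a t * a v * covariance (X t) (X v))"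
  proof (intro sum.cong refl)
    fix t v assume tv: "t \<in> I" "v \<in> I"
    have "covariance (\<lambda>\<omega>. a t * X t \<omega>) (\<lambda>\<omega>. a v * X v \<omega>) =
        expectation (\<lambda>\<omega>. (a t * a v) * (X t \<omega> * X v \<omega>))"
      using tv assms by (simp add: covariance_def ac_simps)
    also have "\<dots> = a t * a v * covariance (X t) (X v)"
      using tv assms by (simp add: covariance_def)
    finally show "covariance (\<lambda>\<omega>. a t * X t \<omega>) (\<lambda>\<omega>. a v * X v \<omega>) = a t * a v * covariance (X t) (X v)" .
  qed
  finally show ?thesis .
qed

context panel_change_point
begin

definition partial_sum :: "nat \<Rightarrow> nat \<Rightarrow> 'a \<Rightarrow> real" where
  "partial_sum i t \<omega> = (\<Sum>s=1..t. \<epsilon> i s \<omega>)"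

definition panel_sum :: "nat \<Rightarrow> nat \<Rightarrow> 'a \<Rightarrow> real" where
  "panel_sum N t \<omega> = (\<Sum>i=1..N. partial_sum i t \<omega>)"

lemma partial_sum_measurable:
  assumes "i \<ge> 1" "t \<in> {1..T}"
  shows "partial_sum i t \<in> borel_measurable M"
  unfolding partial_sum_def[abs_def] using assms
  by (intro borel_measurable_sum error_measurable) auto

lemma panel_sum_measurable:
  assumes "t \<in> {1..T}"
  shows "panel_sum N t \<in> borel_measurable M"
  unfolding panel_sum_def[abs_def] using assms
  by (intro borel_measurable_sum partial_sum_measurable) auto

lemma partial_sum_expectation:
  assumes "i \<ge> 1" "t \<in> {1..T}"
  shows "integrable M (partial_sum i t)" "expectation (partial_sum i t) = 0"
proof -
  have "integrable M (\<epsilon> i s)" "expectation (\<epsilon> i s) = 0" if "s \<in> {1..t}" for s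
    using that assms error_integrable errors_mean by auto
  then show "integrable M (partial_sum i t)" "expectation (partial_sum i t) = 0"
    unfolding partial_sum_def[abs_def]
    by (auto intro!: Bochner_Integration.integrable_sum simp: Bochner_Integration.integral_sum)
qed

lemma partial_sum_product_integrable:
  assumes "i \<ge> 1" "t \<in> {1..T}" "v \<in> {1..T}"
  shows "integrable M (\<lambda>\<omega>. partial_sum i t \<omega> * partial_sum i v \<omega>)"
  unfolding partial_sum_def sum_product using assms
  by (intro Bochner_Integration.integrable_sum error_product_integrable) auto

text \<open>
  For \<open>t < v\<close> the later sum is the earlier one plus the block from \<open>t + 1\<close> to \<open>v\<close>; the two
  contributions are the cumulative and the shifted cumulative correlation.
\<close>

lemma partial_sum_covariance:
  assumes "i \<ge> 1" "t \<in> {1..T}" "v \<in> {1..T}"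
  shows "covariance (partial_sum i t) (partial_sum i v) = limit_cov (\<epsilon> i) t v"
proof -
  have lt: "covariance (partial_sum i t) (partial_sum i v) = cum_autocorr (\<epsilon> i) t + shifted_cum_corr (\<epsilon> i) t v"
    if "t < v" "t \<in> {1..T}" "v \<in> {1..T}" for t v
  proof -
    have "covariance (partial_sum i t) (partial_sum i v) =
        (\<Sum>a=1..t. \<Sum>b=1..v. covariance (\<epsilon> i a) (\<epsilon> i b))"
      unfolding partial_sum_def[abs_def] using that assms(1)
      by (intro covariance_sum error_integrable errors_mean error_product_integrable) auto
    also have "\<dots> = (\<Sum>a=1..t. (\<Sum>b=1..t. covariance (\<epsilon> i a) (\<epsilon> i b)) +
        (\<Sum>b=t+1..v. covariance (\<epsilon> i a) (\<epsilon> i b)))"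
    proof (rule sum.cong[OF refl])
      fix a
      show "(\<Sum>b=1..v. covariance (\<epsilon> i a) (\<epsilon> i b)) = (\<Sum>b=1..t. covariance (\<epsilon> i a) (\<epsilon> i b)) +
        (\<Sum>b=t+1..v. covariance (\<epsilon> i a) (\<epsilon> i b))"
        using that sum.ub_add_nat[of 1 t "\<lambda>b. covariance (\<epsilon> i a) (\<epsilon> i b)" "v - t"] by simp
    qed
    also have "\<dots> = (\<Sum>a=1..t. \<Sum>b=1..t. covariance (\<epsilon> i a) (\<epsilon> i b)) +
        (\<Sum>a=1..t. \<Sum>b=t+1..v. covariance (\<epsilon> i a) (\<epsilon> i b))"
      by (rule sum.distrib)
    also have "(\<Sum>a=1..t. \<Sum>b=1..t. covariance (\<epsilon> i a) (\<epsilon> i b)) =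
        covariance (\<lambda>\<omega>. \<Sum>a=1..t. \<epsilon> i a \<omega>) (\<lambda>\<omega>. \<Sum>a=1..t. \<epsilon> i a \<omega>)"
      using that assms(1)
      by (intro covariance_sum[symmetric] error_integrable errors_mean error_product_integrable) auto
    also have "\<dots> = cum_autocorr (\<epsilon> i) t"
      by (simp add: cum_autocorr_def covariance_def power2_eq_square)
    also have "(\<Sum>a=1..t. \<Sum>b=t+1..v. covariance (\<epsilon> i a) (\<epsilon> i b)) = shifted_cum_corr (\<epsilon> i) t v"
      unfolding shifted_cum_corr_def using that assms(1)
      by (intro covariance_sum[symmetric] error_integrable errors_mean error_product_integrable) auto
    finally show ?thesis .
  qed
  have sym: "covariance X Y = covariance Y X" for X Y
    by (simp add: covariance_def mult.commute)
  consider "t = v" | "t < v" | "v < t" by linarith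
  then show ?thesis
  proof cases
    case 1
    then show ?thesis
      by (simp add: limit_cov_def cum_autocorr_def covariance_def power2_eq_square partial_sum_def[abs_def])
  next
    case 2
    then show ?thesis using lt assms by (simp add: limit_cov_def)
  next
    case 3
    then show ?thesis using lt[of v t] assms by (simp add: limit_cov_def sym[of "partial_sum i t"])
  qed
qed

lemma limit_cov_panel_independent:
  assumes "i \<ge> 1" "t \<in> {1..T}" "v \<in> {1..T}"
  shows "limit_cov (\<epsilon> i) t v = limit_cov (\<epsilon> 1) t v"
  using assms by (auto simp: limit_cov_def cum_autocorr_eq shifted_cum_corr_eq)

lemma partial_sum_combination_variance:
  assumes "i \<ge> 1"
  shows "variance (\<lambda>\<omega>. \<Sum>t=1..T. a t * partial_sum i t \<omega>) =
    (\<Sum>t=1..T. \<Sum>v=1..T. a t * a v * limit_cov (\<epsilon> 1) t v)"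
proof -
  have "variance (\<lambda>\<omega>. \<Sum>t=1..T. a t * partial_sum i t \<omega>) =
      (\<Sum>t=1..T. \<Sum>v=1..T. a t * a v * covariance (partial_sum i t) (partial_sum i v))"
    using assms partial_sum_expectation partial_sum_product_integrable
    by (intro variance_linear_combination) auto
  also have "\<dots> = (\<Sum>t=1..T. \<Sum>v=1..T. a t * a v * limit_cov (\<epsilon> 1) t v)"
    using assms
    by (intro sum.cong refl) (simp only: partial_sum_covariance limit_cov_panel_independent[of i])
  finally show ?thesis .
qed

lemma partial_sum_combination_square_integrable:
  assumes "i \<ge> 1"
  shows "integrable M (\<lambda>\<omega>. (\<Sum>t=1..T. a t * partial_sum i t \<omega>)\<^sup>2)"
proof -
  have "integrable M (\<lambda>\<omega>. \<Sum>t=1..T. \<Sum>v=1..T. (a t * a v) * (partial_sum i t \<omega> * partial_sum i v \<omega>))"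
    using assms by (intro Bochner_Integration.integrable_sum integrable_mult_right partial_sum_product_integrable)
  then show ?thesis
    by (simp add: power2_eq_square sum_product ac_simps)
qed

end

locale panel_gaussian_limit = panel_change_point +
  fixes Q :: "'b measure" and X :: "nat \<Rightarrow> 'b \<Rightarrow> real"
  assumes gaussian: "multivariate_normal Q {1..T} X (\<lambda>_. 0) (limit_cov (\<epsilon> 1))"
begin

sublocale Q: prob_space Q
  using gaussian by (simp add: multivariate_normal_def)

lemma limit_measurable: "t \<in> {1..T} \<Longrightarrow> X t \<in> borel_measurable Q"
  using gaussian by (simp add: multivariate_normal_def)

text \<open>
  The definition of normality only provides some centre and scale for every linear combination. They
  are identified as mean and standard deviation, which the covariance matrix determines once square
  integrability of the coordinates is known; that follows from the normal law of each single coordinate.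
\<close>

lemma limit_combination_law:
  obtains s where "0 \<le> s" "distr Q borel (\<lambda>\<omega>. \<Sum>t=1..T. a t * X t \<omega>) = normal_law 0 s"
    "s\<^sup>2 = (\<Sum>t=1..T. \<Sum>v=1..T. a t * a v * limit_cov (\<epsilon> 1) t v)"
proof -
  have normal: "\<exists>c s. 0 \<le> s \<and> distr Q borel (\<lambda>\<omega>. \<Sum>t=1..T. a t * X t \<omega>) = normal_law c s" for a
    using gaussian by (auto simp: multivariate_normal_def)
  have meas: "(\<lambda>\<omega>. \<Sum>t=1..T. a t * X t \<omega>) \<in> borel_measurable Q" for a
    using limit_measurable by (intro borel_measurable_sum borel_measurable_times) auto
  have sq: "integrable Q (\<lambda>\<omega>. (X t \<omega>)\<^sup>2)" if t: "t \<in> {1..T}" for t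
  proof -
    obtain c s where "0 \<le> s" "distr Q borel (\<lambda>\<omega>. \<Sum>u=1..T. of_bool (u = t) * X u \<omega>) = normal_law c s"
      using normal[of "\<lambda>u. of_bool (u = t)"] by auto
    from Q.normal_law_square_integrable[OF this(1) meas this(2)] show ?thesis
      using t by (simp add: sum.remove[of "{1..T}" t])
  qed
  have int: "integrable Q (X t)" if t: "t \<in> {1..T}" for t
    using Q.square_integrable_imp_integrable[OF limit_measurable[OF t] sq[OF t]] .
  have mean: "Q.expectation (X t) = 0" and cov: "v \<in> {1..T} \<Longrightarrow> Q.covariance (X t) (X v) = limit_cov (\<epsilon> 1) t v"
    if "t \<in> {1..T}" for t v
    using gaussian that by (auto simp: multivariate_normal_def)
  have prod: "integrable Q (\<lambda>\<omega>. X t \<omega> * X v \<omega>)" if "t \<in> {1..T}" "v \<in> {1..T}" for t v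
  proof (rule Bochner_Integration.integrable_bound)
    show "integrable Q (\<lambda>\<omega>. (X t \<omega>)\<^sup>2 + (X v \<omega>)\<^sup>2)"
      using sq that by simp
    show "(\<lambda>\<omega>. X t \<omega> * X v \<omega>) \<in> borel_measurable Q"
      using limit_measurable that by simp
    have "\<bar>x * y\<bar> \<le> x\<^sup>2 + y\<^sup>2" for x y :: real
    proof -
      have "2 * (\<bar>x\<bar> * \<bar>y\<bar>) \<le> x\<^sup>2 + y\<^sup>2"
        using sum_squares_bound[of "\<bar>x\<bar>" "\<bar>y\<bar>"] by (simp add: mult.assoc)
      moreover have "0 \<le> \<bar>x\<bar> * \<bar>y\<bar>" by simp
      ultimately show ?thesis unfolding abs_mult by linarith
    qed
    then show "AE \<omega> in Q. norm (X t \<omega> * X v \<omega>) \<le> norm ((X t \<omega>)\<^sup>2 + (X v \<omega>)\<^sup>2)"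
      by (intro AE_I2) simp
  qed
  obtain c s where s: "0 \<le> s" and law: "distr Q borel (\<lambda>\<omega>. \<Sum>t=1..T. a t * X t \<omega>) = normal_law c s"
    using normal[of a] by auto
  have "c = Q.expectation (\<lambda>\<omega>. \<Sum>t=1..T. a t * X t \<omega>)"
    by (rule Q.normal_law_expectation[OF s meas law, symmetric])
  also have "\<dots> = 0"
    using int mean by simp
  finally have c: "c = 0" .
  have "s\<^sup>2 = Q.variance (\<lambda>\<omega>. \<Sum>t=1..T. a t * X t \<omega>)"
    by (rule Q.normal_law_variance[OF s meas law, symmetric])
  also have "\<dots> = (\<Sum>t=1..T. \<Sum>v=1..T. a t * a v * Q.covariance (X t) (X v))"
    using int mean prod by (intro Q.variance_linear_combination) auto
  also have "\<dots> = (\<Sum>t=1..T. \<Sum>v=1..T. a t * a v * limit_cov (\<epsilon> 1) t v)"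
    by (intro sum.cong refl) (simp only: cov)
  finally have "s\<^sup>2 = (\<Sum>t=1..T. \<Sum>v=1..T. a t * a v * limit_cov (\<epsilon> 1) t v)" .
  then show thesis
    using law by (intro that[OF s]) (simp_all only: c)
qed

lemma limit_combination_variance:
  obtains s where "0 \<le> s" "distr Q borel (\<lambda>\<omega>. \<Sum>t=1..T. a t * X t \<omega>) = normal_law 0 s"
    "\<And>i. i \<ge> 1 \<Longrightarrow> variance (\<lambda>\<omega>. \<Sum>t=1..T. a t * partial_sum i t \<omega>) = s\<^sup>2"
proof -
  obtain s where s: "0 \<le> s" "distr Q borel (\<lambda>\<omega>. \<Sum>t=1..T. a t * X t \<omega>) = normal_law 0 s"
    "s\<^sup>2 = (\<Sum>t=1..T. \<Sum>v=1..T. a t * a v * limit_cov (\<epsilon> 1) t v)"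
    by (rule limit_combination_law)
  show thesis
    by (rule that[OF s(1,2)]) (simp only: s(3) partial_sum_combination_variance)
qed

text \<open>
  By the Cramer--Wold device this is a statement about linear combinations of the coordinates, and each
  of them is a normalised sum of independent, identically distributed variables, one per panel.
\<close>

lemma panel_sums_tend_in_law:
  "tends_in_law M (\<lambda>N \<omega>. \<lambda>t\<in>{1..T}. panel_sum N t \<omega> / sqrt (real N)) Q (\<lambda>\<omega>. \<lambda>t\<in>{1..T}. X t \<omega>)"
proof (rule cramer_wold)
  show "(\<lambda>\<omega>. panel_sum N t \<omega> / sqrt (real N)) \<in> borel_measurable M" if "t \<in> {1..T}" for N t
    using panel_sum_measurable[OF that] by simp
  fix a :: "nat \<Rightarrow> real"
  define L where "L e = (\<Sum>t=1..T. a t * (\<Sum>s=1..t. e s))" for e :: "nat \<Rightarrow> real"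
  define E where "E i \<omega> = (\<lambda>t\<in>{1..T}. \<epsilon> i t \<omega>)" for i \<omega>
  have L[measurable]: "L \<in> borel_measurable (Pi\<^sub>M {1..T} (\<lambda>_. borel))"
    unfolding L_def[abs_def]
    by (intro borel_measurable_sum borel_measurable_times borel_measurable_const
        measurable_component_singleton) auto
  have LE: "L (E i \<omega>) = (\<Sum>t=1..T. a t * partial_sum i t \<omega>)" for i \<omega>
    unfolding L_def E_def partial_sum_def by (intro sum.cong refl arg_cong2[where f = "(*)"]) auto
  have indepE: "indep_vars (\<lambda>_. Pi\<^sub>M {1..T} (\<lambda>_. borel)) (\<lambda>n. E (Suc n)) UNIV"
  proof (rule indep_vars_reindex)
    have "range Suc = {1..}"
      by (auto simp: image_iff) (metis Suc_le_D)
    then show "indep_vars (\<lambda>_. Pi\<^sub>M {1..T} (\<lambda>_. borel)) E (range Suc)"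
      using errors_indep unfolding E_def[abs_def] by simp
  qed simp
  have E_meas: "E (Suc n) \<in> measurable M (Pi\<^sub>M {1..T} (\<lambda>_. borel))" for n
    using indepE by (simp add: indep_vars_def2)
  obtain s where s: "0 \<le> s" "distr Q borel (\<lambda>\<omega>. \<Sum>t=1..T. a t * X t \<omega>) = normal_law 0 s"
    "\<And>i. i \<ge> 1 \<Longrightarrow> variance (\<lambda>\<omega>. \<Sum>t=1..T. a t * partial_sum i t \<omega>) = s\<^sup>2"
    by (rule limit_combination_variance[of a]) blast
  have "tends_in_law M (\<lambda>n \<omega>. (\<Sum>i<n. L (E (Suc i) \<omega>)) / sqrt (real n)) Q (\<lambda>\<omega>. \<Sum>t=1..T. a t * X t \<omega>)"
  proof (rule central_limit_theorem_normal_law[OF _ _ _ _ _ s(1) Q.prob_space_axioms _ s(2)])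
    show "indep_vars (\<lambda>_. borel) (\<lambda>n \<omega>. L (E (Suc n) \<omega>)) UNIV"
      using indepE L by (rule indep_vars_compose2)
    show "distr M borel (\<lambda>\<omega>. L (E (Suc n) \<omega>)) = distr M borel (\<lambda>\<omega>. L (E (Suc 0) \<omega>))" for n
    proof -
      have "distr M borel (\<lambda>\<omega>. L (E (Suc n) \<omega>)) = distr (distr M (Pi\<^sub>M {1..T} (\<lambda>_. borel)) (E (Suc n))) borel L" for n
        by (simp only: distr_distr[OF L E_meas] comp_def)
      moreover have "distr M (Pi\<^sub>M {1..T} (\<lambda>_. borel)) (E (Suc n)) = distr M (Pi\<^sub>M {1..T} (\<lambda>_. borel)) (E (Suc 0))"
        unfolding E_def[abs_def] by (rule errors_ident) auto
      ultimately show ?thesis by simp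
    qed
    show "expectation (\<lambda>\<omega>. L (E (Suc n) \<omega>)) = 0" for n
      unfolding LE using partial_sum_expectation[of "Suc n"] by simp
    show "integrable M (\<lambda>\<omega>. (L (E (Suc n) \<omega>))\<^sup>2)" for n
      unfolding LE by (rule partial_sum_combination_square_integrable) simp
    show "variance (\<lambda>\<omega>. L (E (Suc n) \<omega>)) = s\<^sup>2" for n
      unfolding LE by (rule s(3)) simp
    show "(\<lambda>\<omega>. \<Sum>t=1..T. a t * X t \<omega>) \<in> borel_measurable Q"
      using limit_measurable by (intro borel_measurable_sum borel_measurable_times) auto
  qed
  moreover have "(\<Sum>i<n. L (E (Suc i) \<omega>)) / sqrt (real n) =
      (\<Sum>t=1..T. a t * (panel_sum n t \<omega> / sqrt (real n)))" for n \<omega>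
  proof -
    have "(\<Sum>i<n. L (E (Suc i) \<omega>)) = (\<Sum>i=1..n. \<Sum>t=1..T. a t * partial_sum i t \<omega>)"
      unfolding LE by (simp add: sum.atLeast1_atMost_eq)
    also have "\<dots> = (\<Sum>t=1..T. a t * panel_sum n t \<omega>)"
      unfolding panel_sum_def sum_distrib_left by (rule sum.swap)
    finally show ?thesis
      by (simp add: sum_divide_distrib)
  qed
  ultimately show "tends_in_law M (\<lambda>n \<omega>. \<Sum>t=1..T. a t * (panel_sum n t \<omega> / sqrt (real n))) Q
      (\<lambda>\<omega>. \<Sum>t=1..T. a t * X t \<omega>)"
    by simp
qed (use limit_measurable prob_space_axioms Q.prob_space_axioms in auto)

text \<open>
  The Gaussian vector and the partial sums of a single panel have the same covariances. Hence linear
  relations that hold almost surely carry over to the limit, and a linear form that is not almost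
  surely constant for a panel is almost surely nonzero in the limit.
\<close>

lemma combination_AE_zero:
  assumes "i \<ge> 1" and zero: "AE \<omega> in M. (\<Sum>t=1..T. a t * partial_sum i t \<omega>) = 0"
  shows "AE \<omega> in Q. (\<Sum>t=1..T. a t * X t \<omega>) = 0"
proof -
  obtain s where s: "0 \<le> s" "distr Q borel (\<lambda>\<omega>. \<Sum>t=1..T. a t * X t \<omega>) = normal_law 0 s"
    "variance (\<lambda>\<omega>. \<Sum>t=1..T. a t * partial_sum i t \<omega>) = s\<^sup>2"
    by (rule limit_combination_variance[of a]) (use assms(1) in blast)
  have meas: "(\<lambda>\<omega>. \<Sum>t=1..T. a t * X t \<omega>) \<in> borel_measurable Q"
    using limit_measurable by (intro borel_measurable_sum borel_measurable_times) auto
  define Z where "Z \<omega> = (\<Sum>t=1..T. a t * partial_sum i t \<omega>)" for \<omega>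
  have [measurable]: "Z \<in> borel_measurable M"
    unfolding Z_def[abs_def]
    using partial_sum_measurable assms(1) by (intro borel_measurable_sum borel_measurable_times) auto
  have "expectation Z = 0"
    using partial_sum_expectation[OF assms(1)] by (simp add: Z_def[abs_def])
  then have "variance Z = (\<integral>\<omega>. 0 \<partial>M)"
    using zero[folded Z_def] by (intro integral_cong_AE) auto
  then have "s\<^sup>2 = 0"
    using s(3) unfolding Z_def by simp
  then have "normal_law 0 s = return borel 0"
    by (simp add: normal_law_def)
  then have "AE x in distr Q borel (\<lambda>\<omega>. \<Sum>t=1..T. a t * X t \<omega>). x = 0"
    unfolding s(2) by (simp only:) (subst AE_return; simp)
  then show ?thesis
    by (subst (asm) AE_distr_iff[OF meas]) simp_all
qed

lemma combination_AE_nonzero: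
  assumes "i \<ge> 1" and "variance (\<lambda>\<omega>. \<Sum>t=1..T. a t * partial_sum i t \<omega>) \<noteq> 0"
  shows "AE \<omega> in Q. (\<Sum>t=1..T. a t * X t \<omega>) \<noteq> 0"
proof -
  obtain s where s: "0 \<le> s" "distr Q borel (\<lambda>\<omega>. \<Sum>t=1..T. a t * X t \<omega>) = normal_law 0 s"
    "variance (\<lambda>\<omega>. \<Sum>t=1..T. a t * partial_sum i t \<omega>) = s\<^sup>2"
    by (rule limit_combination_variance[of a]) (use assms(1) in blast)
  then have "0 < s" using assms(2) by (cases "s = 0") auto
  then show ?thesis
    using s(2) limit_measurable
    by (intro Q.normal_law_AE_nonzero[where m = 0] borel_measurable_sum borel_measurable_times) auto
qed

end

section \<open>The limit of the ratio statistic\<close>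

context panel_gaussian_limit
begin

lemma measurable_scaled_panel_sums:
  "(\<lambda>\<omega>. \<lambda>t\<in>{1..T}. panel_sum N t \<omega> / sqrt (real N)) \<in> borel_measurable M"
  by (intro measurable_restrict_function borel_measurable_divide borel_measurable_const
      panel_sum_measurable)

lemma measurable_limit_vector: "(\<lambda>\<omega>. \<lambda>t\<in>{1..T}. X t \<omega>) \<in> borel_measurable Q"
  by (intro measurable_restrict_function limit_measurable)

text \<open>
  Stationarity makes this independent of \<open>s\<close>. So if \<open>\<rho> 1 = 1\<close>, then all errors of a panel
  coincide almost surely, and if \<open>\<rho> 1 \<noteq> 1\<close>, then no two consecutive errors do.
\<close>

lemma error_increment_expectation:
  assumes "i \<ge> 1" "s \<ge> 1" "s < T"
  shows "expectation (\<lambda>\<omega>. (\<epsilon> i (s + 1) \<omega> - \<epsilon> i s \<omega>)\<^sup>2) = 2 - 2 * \<rho> 1"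
proof -
  have s: "s \<in> {1..T}" "s + 1 \<in> {1..T}" using assms by auto
  have sq: "integrable M (\<lambda>\<omega>. (\<epsilon> i (s + 1) \<omega>)\<^sup>2)" "integrable M (\<lambda>\<omega>. (\<epsilon> i s \<omega>)\<^sup>2)"
    using error_square_integrable assms(1) s by auto
  have pr: "integrable M (\<lambda>\<omega>. 2 * (\<epsilon> i s \<omega> * \<epsilon> i (s + 1) \<omega>))"
    using error_product_integrable[OF assms(1) s] by simp
  have one: "expectation (\<lambda>\<omega>. (\<epsilon> i t \<omega>)\<^sup>2) = 1" if "t \<in> {1..T}" for t
    using errors_var[OF assms(1) that] errors_mean[OF assms(1) that] by simp
  have rho: "expectation (\<lambda>\<omega>. \<epsilon> i s \<omega> * \<epsilon> i (s + 1) \<omega>) = \<rho> 1"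
    using error_covariance[OF assms(1) s] errors_mean[OF assms(1) s(1)] errors_mean[OF assms(1) s(2)]
    by (simp add: covariance_def)
  have "(\<lambda>\<omega>. (\<epsilon> i (s + 1) \<omega> - \<epsilon> i s \<omega>)\<^sup>2) =
      (\<lambda>\<omega>. (\<epsilon> i (s + 1) \<omega>)\<^sup>2 + (\<epsilon> i s \<omega>)\<^sup>2 - 2 * (\<epsilon> i s \<omega> * \<epsilon> i (s + 1) \<omega>))"
    by (simp add: power2_diff fun_eq_iff ac_simps)
  then have "expectation (\<lambda>\<omega>. (\<epsilon> i (s + 1) \<omega> - \<epsilon> i s \<omega>)\<^sup>2) =
      expectation (\<lambda>\<omega>. (\<epsilon> i (s + 1) \<omega>)\<^sup>2) + expectation (\<lambda>\<omega>. (\<epsilon> i s \<omega>)\<^sup>2) -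
      expectation (\<lambda>\<omega>. 2 * (\<epsilon> i s \<omega> * \<epsilon> i (s + 1) \<omega>))"
    using sq pr by simp
  then show ?thesis
    using one s rho by simp
qed

lemma ratio_limit_tends_nondegenerate:
  assumes T: "T \<ge> 4" and rho: "\<rho> 1 \<noteq> 1"
  shows "tends_in_law M (\<lambda>N \<omega>. ratio_limit T (\<lambda>t\<in>{1..T}. panel_sum N t \<omega> / sqrt (real N)))
    Q (\<lambda>\<omega>. ratio_limit T (\<lambda>t\<in>{1..T}. X t \<omega>))"
proof -
  let ?d = "\<lambda>x :: nat \<Rightarrow> real. x T - 2 * x (T - 1) + x (T - 2)"
  \<comment> \<open>The coefficients of the form \<open>?d\<close>; applied to partial sums it yields \<open>\<epsilon> 1 T - \<epsilon> 1 (T - 1)\<close>.\<close>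
  define a :: "nat \<Rightarrow> real" where
    "a t = of_bool (t = T) - 2 * of_bool (t = T - 1) + of_bool (t = T - 2)" for t
  have a: "(\<Sum>t=1..T. a t * y t) = y T - 2 * y (T - 1) + y (T - 2)" for y :: "nat \<Rightarrow> real"
  proof -
    have pick: "(\<Sum>t=1..T. of_bool (t = k) * y t) = y k" if "k \<in> {1..T}" for k
      using that by (simp add: sum.remove[of "{1..T}" k])
    have "(\<Sum>t=1..T. a t * y t) = (\<Sum>t=1..T. of_bool (t = T) * y t)
        - 2 * (\<Sum>t=1..T. of_bool (t = T - 1) * y t) + (\<Sum>t=1..T. of_bool (t = T - 2) * y t)"
      unfolding a_def sum_distrib_left sum_subtractf[symmetric] sum.distrib[symmetric]
      by (intro sum.cong refl) (simp add: algebra_simps)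
    moreover have "T \<in> {1..T}" "T - 1 \<in> {1..T}" "T - 2 \<in> {1..T}" using T by auto
    ultimately show ?thesis by (simp only: pick)
  qed
  have incr: "(\<Sum>t=1..T. a t * partial_sum 1 t \<omega>) = \<epsilon> 1 (T - 1 + 1) \<omega> - \<epsilon> 1 (T - 1) \<omega>" for \<omega>
  proof -
    have k: "T = Suc (Suc (T - 2))" using T by simp
    define k where "k = T - 2"
    note k = k[folded k_def]
    show ?thesis unfolding a by (simp add: k partial_sum_def)
  qed
  have "variance (\<lambda>\<omega>. \<Sum>t=1..T. a t * partial_sum 1 t \<omega>) = 2 - 2 * \<rho> 1"
  proof -
    have "expectation (\<lambda>\<omega>. \<Sum>t=1..T. a t * partial_sum 1 t \<omega>) = 0"
      using partial_sum_expectation[of 1] by simp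
    then have "variance (\<lambda>\<omega>. \<Sum>t=1..T. a t * partial_sum 1 t \<omega>) =
        expectation (\<lambda>\<omega>. (\<epsilon> 1 (T - 1 + 1) \<omega> - \<epsilon> 1 (T - 1) \<omega>)\<^sup>2)"
      by (simp only: incr diff_zero)
    also have "\<dots> = 2 - 2 * \<rho> 1"
      using T by (intro error_increment_expectation) auto
    finally show ?thesis .
  qed
  then have "AE \<omega> in Q. (\<Sum>t=1..T. a t * X t \<omega>) \<noteq> 0"
    using rho by (intro combination_AE_nonzero[of 1]) auto
  then have nz: "AE \<omega> in Q. ?d (\<lambda>t\<in>{1..T}. X t \<omega>) \<noteq> 0"
    unfolding a using T by (auto elim!: eventually_mono)
  have cont: "continuous_on UNIV ?d"
    by (intro continuous_intros continuous_on_product_coordinates)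
  show ?thesis
    by (rule tends_in_law_ae_continuous_image[where g = "ratio_limit T" and d = ?d,
          OF prob_space_axioms Q.prob_space_axioms _ _ _ panel_sums_tend_in_law])
       (fact measurable_scaled_panel_sums measurable_limit_vector measurable_ratio_limit
         cont continuous_on_ratio_limit[OF T] nz)+
qed

text \<open>
  Here the partial sums of every panel are almost surely linear in time, and so is the limit vector.
  Both the statistic and its limit are then almost surely \<open>0\<close>.
\<close>

lemma ratio_limit_tends_degenerate:
  assumes T: "T \<ge> 4" and rho: "\<rho> 1 = 1"
  shows "tends_in_law M (\<lambda>N \<omega>. ratio_limit T (\<lambda>t\<in>{1..T}. panel_sum N t \<omega> / sqrt (real N)))
    Q (\<lambda>\<omega>. ratio_limit T (\<lambda>t\<in>{1..T}. X t \<omega>))"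
proof -
  have step: "AE \<omega> in M. \<epsilon> i (s + 1) \<omega> = \<epsilon> i s \<omega>" if i: "i \<ge> 1" and s: "s \<ge> 1" "s < T" for i s
  proof -
    have "integrable M (\<lambda>\<omega>. (\<epsilon> i (s + 1) \<omega>)\<^sup>2 + (\<epsilon> i s \<omega>)\<^sup>2 - 2 * (\<epsilon> i (s + 1) \<omega> * \<epsilon> i s \<omega>))"
      using i s by (intro Bochner_Integration.integrable_add Bochner_Integration.integrable_diff
          integrable_mult_right error_square_integrable error_product_integrable) auto
    then have "integrable M (\<lambda>\<omega>. (\<epsilon> i (s + 1) \<omega> - \<epsilon> i s \<omega>)\<^sup>2)"
      by (simp add: power2_diff mult.assoc)
    then have "AE \<omega> in M. (\<epsilon> i (s + 1) \<omega> - \<epsilon> i s \<omega>)\<^sup>2 = 0"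
      using error_increment_expectation[OF i s] rho
      by (subst integral_nonneg_eq_0_iff_AE[symmetric]) auto
    then show ?thesis by (auto elim!: eventually_mono)
  qed
  have const: "AE \<omega> in M. \<forall>t\<in>{1..T}. partial_sum i t \<omega> = real t * \<epsilon> i 1 \<omega>" if i: "i \<ge> 1" for i
  proof -
    have "AE \<omega> in M. \<forall>s\<in>{1..<T}. \<epsilon> i (s + 1) \<omega> = \<epsilon> i s \<omega>"
      using step[OF i] by (subst AE_ball_countable) auto
    then show ?thesis
    proof eventually_elim
      case (elim \<omega>)
      have e: "\<epsilon> i s \<omega> = \<epsilon> i 1 \<omega>" if "s \<ge> 1" "s \<le> T" for s
        using that
      proof (induction s rule: nat_induct_at_least)
        case (Suc s)
        have "\<epsilon> i (s + 1) \<omega> = \<epsilon> i s \<omega>"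
          using Suc.hyps Suc.prems by (intro elim[rule_format]) simp
        with Suc show ?case by simp
      qed simp
      then have "partial_sum i t \<omega> = (\<Sum>s=1..t. \<epsilon> i 1 \<omega>)" if "t \<in> {1..T}" for t
        unfolding partial_sum_def using that by (intro sum.cong refl e) simp_all
      then show ?case by simp
    qed
  qed
  have "AE \<omega> in M. \<forall>i\<in>{1..}. \<forall>t\<in>{1..T}. partial_sum i t \<omega> = real t * \<epsilon> i 1 \<omega>"
    using const by (subst AE_ball_countable) auto
  then have M0: "AE \<omega> in M. ratio_limit T (\<lambda>t\<in>{1..T}. panel_sum N t \<omega> / sqrt (real N)) = 0" for N
  proof eventually_elim
    case (elim \<omega>)
    let ?a = "(\<Sum>i=1..N. \<epsilon> i 1 \<omega>) / sqrt (real N)"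
    have "panel_sum N t \<omega> / sqrt (real N) = real t * ?a"
      if "t \<in> {1..T}" for t
      using elim that by (simp add: panel_sum_def sum_distrib_left)
    then show ?case
      by (intro ratio_limit_linear[OF T, where a = ?a]) (simp only: restrict_apply')
  qed
  have "AE \<omega> in Q. X t \<omega> = real t * X 1 \<omega>" if t: "t \<in> {1..T}" for t
  proof -
    let ?a = "\<lambda>u. of_bool (u = t) - real t * of_bool (u = 1)"
    have a: "(\<Sum>u=1..T. ?a u * y u) = y t - real t * y 1" for y :: "nat \<Rightarrow> real"
    proof -
      have pick: "(\<Sum>u=1..T. of_bool (u = k) * y u) = y k" if "k \<in> {1..T}" for k
        using that by (simp add: sum.remove[of "{1..T}" k])
      have "(\<Sum>u=1..T. ?a u * y u) =
          (\<Sum>u=1..T. of_bool (u = t) * y u) - real t * (\<Sum>u=1..T. of_bool (u = 1) * y u)"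
        unfolding sum_distrib_left sum_subtractf[symmetric]
        by (intro sum.cong refl) (simp add: algebra_simps)
      moreover have "1 \<in> {1..T}" using T by auto
      ultimately show ?thesis using t by (simp only: pick)
    qed
    have "AE \<omega> in M. (\<Sum>u=1..T. ?a u * partial_sum 1 u \<omega>) = 0"
      using const[of 1, OF order_refl] unfolding a
    proof eventually_elim
      case (elim \<omega>)
      have "1 \<in> {1..T}" using T by auto
      with elim t show ?case by (auto simp: partial_sum_def)
    qed
    from combination_AE_zero[OF order_refl this] show ?thesis
      unfolding a by simp
  qed
  then have "AE \<omega> in Q. \<forall>t\<in>{1..T}. X t \<omega> = real t * X 1 \<omega>"
    by (subst AE_ball_countable) auto
  then have Q0: "AE \<omega> in Q. ratio_limit T (\<lambda>t\<in>{1..T}. X t \<omega>) = 0"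
  proof eventually_elim
    case (elim \<omega>)
    then show ?case
      by (intro ratio_limit_linear[OF T, where a = "X 1 \<omega>"]) (simp only: restrict_apply')
  qed
  show ?thesis
    unfolding tends_in_law_def
  proof (intro allI impI)
    fix f :: "real \<Rightarrow> real" assume "continuous_on UNIV f"
    then have f: "f \<in> borel_measurable borel"
      by (rule borel_measurable_continuous_onI)
    have const: "(\<integral>\<omega>. f (W \<omega>) \<partial>P) = f 0"
      if "prob_space P" "AE \<omega> in P. W \<omega> = 0" "W \<in> borel_measurable P"
      for P :: "'c measure" and W
    proof -
      interpret P: prob_space P by fact
      have "(\<integral>\<omega>. f (W \<omega>) \<partial>P) = (\<integral>\<omega>. f 0 \<partial>P)"
        using that(2) measurable_compose[OF that(3) f]
        by (intro integral_cong_AE) (auto elim!: eventually_mono)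
      then show ?thesis by (simp add: P.prob_space)
    qed
    show "(\<lambda>n. \<integral>\<omega>. f (ratio_limit T (\<lambda>t\<in>{1..T}. panel_sum n t \<omega> / sqrt (real n))) \<partial>M)
        \<longlonglongrightarrow> (\<integral>\<omega>. f (ratio_limit T (\<lambda>t\<in>{1..T}. X t \<omega>)) \<partial>Q)"
      by (simp only: const[OF prob_space_axioms M0] const[OF Q.prob_space_axioms Q0] tendsto_const
          measurable_compose[OF measurable_scaled_panel_sums measurable_ratio_limit]
          measurable_compose[OF measurable_limit_vector measurable_ratio_limit])
  qed
qed

lemma ratio_stat_eq_ratio_limit_panel_sum:
  assumes T: "T \<ge> 4"
  shows "ratio_stat T N (\<lambda>i t. panel_obs \<mu> \<delta> \<sigma> T \<epsilon> i t \<omega>) =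
    ratio_limit T (\<lambda>t\<in>{1..T}. panel_sum N t \<omega> / sqrt (real N))"
proof -
  have "ratio_stat T N (\<lambda>i t. panel_obs \<mu> \<delta> \<sigma> T \<epsilon> i t \<omega>) = ratio_limit T (\<lambda>t. panel_sum N t \<omega>)"
    unfolding panel_sum_def partial_sum_def by (rule ratio_stat_no_change[OF T scale_pos])
  also have "\<dots> = ratio_limit T (\<lambda>t. panel_sum N t \<omega> / sqrt (real N))"
    \<comment> \<open>For \<open>N = 0\<close> the scaling factor is \<open>1 / sqrt 0 = 0\<close>, but then all panel sums vanish anyway.\<close>
  proof (cases "N = 0")
    case True
    then show ?thesis by (simp add: panel_sum_def)
  next
    case False
    then show ?thesis
      using ratio_limit_scale[OF T, of "1 / sqrt (real N)" "\<lambda>t. panel_sum N t \<omega>"] by simp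
  qed
  also have "\<dots> = ratio_limit T (\<lambda>t\<in>{1..T}. panel_sum N t \<omega> / sqrt (real N))"
    by (rule ratio_limit_cong[OF T]) simp
  finally show ?thesis .
qed

end

theorem theorem1:
  fixes M :: "'a measure" and Q :: "'b measure"
    and T \<tau> :: nat and \<mu> \<delta> :: "nat \<Rightarrow> real" and \<sigma> :: real
    and \<epsilon> :: "nat \<Rightarrow> nat \<Rightarrow> 'a \<Rightarrow> real" and \<rho> :: "int \<Rightarrow> real"
    and X :: "nat \<Rightarrow> 'b \<Rightarrow> real"
  assumes "panel_change_point M T \<tau> \<sigma> \<epsilon> \<rho>"
    and "\<tau> = T" and "T \<ge> 4"
    and "multivariate_normal Q {1..T} X (\<lambda>_. 0) (prob_space.limit_cov M (\<epsilon> 1))"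
  shows "weak_conv_m
           (\<lambda>N. distr M borel (\<lambda>\<omega>. ratio_stat T N (\<lambda>i t. panel_obs \<mu> \<delta> \<sigma> \<tau> \<epsilon> i t \<omega>)))
           (distr Q borel (\<lambda>\<omega>. ratio_limit T (\<lambda>t. X t \<omega>)))"
proof -
  interpret panel_gaussian_limit M T \<tau> \<sigma> \<epsilon> \<rho> Q X
    using assms(1,4) by (simp add: panel_gaussian_limit_def panel_gaussian_limit_axioms_def)
  have X: "ratio_limit T (\<lambda>t. X t \<omega>) = ratio_limit T (\<lambda>t\<in>{1..T}. X t \<omega>)" for \<omega>
    by (rule ratio_limit_cong[OF assms(3)]) simp
  have "tends_in_law M (\<lambda>N \<omega>. ratio_limit T (\<lambda>t\<in>{1..T}. panel_sum N t \<omega> / sqrt (real N)))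
    Q (\<lambda>\<omega>. ratio_limit T (\<lambda>t\<in>{1..T}. X t \<omega>))"
    using ratio_limit_tends_degenerate[OF assms(3)] ratio_limit_tends_nondegenerate[OF assms(3)]
    by blast
  from tends_in_law_imp_weak_conv_m[OF prob_space_axioms Q.prob_space_axioms
      measurable_compose[OF measurable_scaled_panel_sums measurable_ratio_limit]
      measurable_compose[OF measurable_limit_vector measurable_ratio_limit] this]
  show ?thesis
    unfolding assms(2) X ratio_stat_eq_ratio_limit_panel_sum[OF assms(3)] .
qed

end
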